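(* Let $n\ge2$, let $\Omega\subset\mathbb{R}^n$ be a bounded domain that satisfies the separation property, and let $\delta,\tau\in(0,1)$. Then the following three conditions are equivalent. (1) $\Omega$ is a $1$-John domain. (2) For every $\gamma\in(0,1)$ there exists a constant $C>0$ such that for every Lebesgue measurable set $U\subset\Omega$ with $|U|/|\Omega|\le\gamma$ one can find a set $\mathcal{N}_U$ of Lebesgue measure zero, with $\mathcal{N}_U=\emptyset$ if $U$ is open, and a covering $\{B(x_i,r_i)\}_{i}$ of $U\setminus\mathcal{N}_U$ with $$\sum_i r_i^{n-\delta}\le C(1-\delta)\,\mathcal{P}_{\delta,\tau}(U,\Omega).$$ (3) There exists a constant $C>0$ such that for every Lebesgue measurable set $U\subset\Omega$, $$\min\{|U|,|\Omega\setminus U|\}^{(n-\delta)/n}\le C(1-\delta)\,\mathcal{P}_{\delta,\tau}(U,\Omega).$$ Moreover the constant $C$ in (3) is independent of $\delta$, i.e. when these conditions hold, $C$ in (3) can be chosen (for given $\Omega$ and $\tau$) to be the same for all $\delta\in(0,1)$.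
   Context: A domain is a nonempty open connected set; $d(x)=d(x,\partial\Omega)=\operatorname{dist}(x,\partial\Omega)$; $|U|$ is Lebesgue measure. Coverings by balls are at most countable (possibly finite or empty). Separation property: there exist $x_0\in\Omega$ and $C_0\ge1$ such that for every $x\in\Omega$ there is a curve $\gamma:[0,1]\to\Omega$ with $\gamma(0)=x$, $\gamma(1)=x_0$, such that for each $t\in[0,1]$, with $B_t:=B(\gamma(t),C_0 d(\gamma(t),\partial\Omega))$, either $\gamma([0,t])\subset B_t$, or each $y\in\gamma([0,t])\setminus B_t$ and $x_0$ belong to different components of $\Omega\setminus\partial B_t$. A bounded domain $\Omega$ is a $1$-John domain if there are $C_J\ge1$ and $x_J\in\Omega$ such that each $x\in\Omega$ can be joined to $x_J$ by a rectifiable curve $\gamma:[0,1]\to\Omega$, $\gamma(0)=x$, $\gamma(1)=x_J$, with $C_J\,d(\gamma(t),\partial\Omega)>|\gamma(t)-x|$ for all $t\in[0,1]$ (replacing $|\gamma(t)-x|$ by the diameter or the length of $\gamma([0,t])$ gives the same class of domains). For measurable $U\subset\Omega$, $$\mathcal{P}_{\delta,\tau}(U,\Omega):=\int_\Omega\int_{\{x\in\Omega:\,|x-y|<\tau d(y)\}}\frac{|\chi_U(x)-\chi_U(y)|}{|x-y|^{n+\delta}}\,dx\,dy.$$ *)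

theory Defs
  imports "HOL-Analysis.Analysis"
begin

definition bdry_dist :: "(real ^ 'n) set \<Rightarrow> real ^ 'n \<Rightarrow> real" where
  "bdry_dist \<Omega> x = infdist x (frontier \<Omega>)"

definition domain :: "(real ^ 'n) set \<Rightarrow> bool" where
  "domain \<Omega> \<longleftrightarrow> \<Omega> \<noteq> {} \<and> open \<Omega> \<and> connected \<Omega>"

definition curve_in :: "(real ^ 'n) set \<Rightarrow> real ^ 'n \<Rightarrow> real ^ 'n \<Rightarrow> (real \<Rightarrow> real ^ 'n) \<Rightarrow> bool" where
  "curve_in \<Omega> x y g \<longleftrightarrow> path g \<and> path_image g \<subseteq> \<Omega> \<and> pathstart g = x \<and> pathfinish g = y"

definition rectifiable :: "(real \<Rightarrow> real ^ 'n) \<Rightarrow> bool" where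
  "rectifiable g \<longleftrightarrow>
     bdd_above {(\<Sum>i<m. dist (g (t i)) (g (t (Suc i)))) | (m :: nat) (t :: nat \<Rightarrow> real).
                  mono t \<and> range t \<subseteq> {0..1}}"

(* A point of frontier B lies in no component of \<Omega> - frontier B.  As balls are open, the curve
   portion g ` {0..t} meets frontier B whenever it is not contained in B, so "y and x0 belong to
   different components" is read as "no component contains both y and x0", which is automatic
   for y on frontier B. *)
definition separation_property :: "(real ^ 'n) set \<Rightarrow> bool" where
  "separation_property \<Omega> \<longleftrightarrow>
     (\<exists>x0\<in>\<Omega>. \<exists>C0\<ge>1. \<forall>x\<in>\<Omega>. \<exists>g. curve_in \<Omega> x x0 g \<and>
        (\<forall>t\<in>{0..1}. let B = ball (g t) (C0 * bdry_dist \<Omega> (g t)) in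
             g ` {0..t} \<subseteq> B \<or>
             (\<forall>y \<in> g ` {0..t} - B. \<not> connected_component (\<Omega> - frontier B) y x0)))"

definition one_John_domain :: "(real ^ 'n) set \<Rightarrow> bool" where
  "one_John_domain \<Omega> \<longleftrightarrow> bounded \<Omega> \<and> domain \<Omega> \<and>
     (\<exists>CJ\<ge>1. \<exists>xJ\<in>\<Omega>. \<forall>x\<in>\<Omega>. \<exists>g. curve_in \<Omega> x xJ g \<and> rectifiable g \<and>
        (\<forall>t\<in>{0..1}. CJ * bdry_dist \<Omega> (g t) > norm (g t - x)))"

(* On the diagonal x = y the integrand is 0 / 0 = 0. *)
definition frac_perimeter ::
    "real \<Rightarrow> real \<Rightarrow> (real ^ 'n) set \<Rightarrow> (real ^ 'n) set \<Rightarrow> ennreal" where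
  "frac_perimeter \<delta> \<tau> U \<Omega> =
     (\<integral>\<^sup>+y\<in>\<Omega>.
        (\<integral>\<^sup>+x\<in>{x \<in> \<Omega>. norm (x - y) < \<tau> * bdry_dist \<Omega> y}.
           ennreal (\<bar>indicator U x - indicator U y\<bar> / norm (x - y) powr (real CARD('n) + \<delta>))
         \<partial>lebesgue)
      \<partial>lebesgue)"

definition boxing_inequality :: "real \<Rightarrow> real \<Rightarrow> (real ^ 'n) set \<Rightarrow> bool" where
  "boxing_inequality \<delta> \<tau> \<Omega> \<longleftrightarrow>
     (\<forall>\<gamma>\<in>{0<..<1}. \<exists>C>0. \<forall>U \<in> sets lebesgue.
        U \<subseteq> \<Omega> \<and> measure lebesgue U / measure lebesgue \<Omega> \<le> \<gamma> \<longrightarrow>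
        (\<exists>N \<in> null_sets lebesgue. (open U \<longrightarrow> N = {}) \<and>
           (\<exists>(I :: nat set) (c :: nat \<Rightarrow> real ^ 'n) (r :: nat \<Rightarrow> real).
              (\<forall>i\<in>I. r i > 0) \<and> U - N \<subseteq> (\<Union>i\<in>I. ball (c i) (r i)) \<and>
              (\<Sum>\<^sub>\<infinity>i\<in>I. ennreal (r i powr (real CARD('n) - \<delta>)))
                \<le> ennreal (C * (1 - \<delta>)) * frac_perimeter \<delta> \<tau> U \<Omega>)))"

definition isoperimetric_ineq :: "real \<Rightarrow> real \<Rightarrow> real \<Rightarrow> (real ^ 'n) set \<Rightarrow> bool" where
  "isoperimetric_ineq C \<delta> \<tau> \<Omega> \<longleftrightarrow>
     (\<forall>U \<in> sets lebesgue. U \<subseteq> \<Omega> \<longrightarrow>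
        ennreal (min (measure lebesgue U) (measure lebesgue (\<Omega> - U))
                   powr ((real CARD('n) - \<delta>) / real CARD('n)))
          \<le> ennreal (C * (1 - \<delta>)) * frac_perimeter \<delta> \<tau> U \<Omega>)"

end

(*
A ball in which U has density one half satisfies r^(n - d) <= C (1 - d) times the energy of the ball;
the factor 1 - d comes from comparing the energy at dyadic scales, which form a geometric series.
In a John domain the density of U along a curve of balls from a density point of U to the centre
passes through one half (or the same holds for the complement of U), and Vitali's covering lemma
turns these balls into a boxing cover; the isoperimetric inequality is the subadditive consequence.
Conversely, under the separation property a point x far from z = g t lies in a component D of the
complement of a sphere of radius comparable to the distance from z to the boundary. Averaging the
isoperimetric inequality for D minus a ball about z over the radius of the ball gives a decay
estimate for the volume, and De Giorgi's iteration shows that D, hence x, is at distance at most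
a constant times this radius.
*)

theory Submission
  imports Defs
begin

subsection \<open>Energies at a fixed scale\<close>

text \<open>The truncation |x - y| < \<tau> d(y) shapes both directions. In a John domain it limits
  the balls to radius at most \<tau>/4 times the boundary distance of their centre, so that all
  pairs inside a ball are counted. In the converse it hides the sphere that bounds D: a counted pair
  whose segment crosses that sphere stays within a fixed multiple of its radius, so D minus a larger
  ball interacts only with points of D. For one fixed ball this interaction has no direct bound,
  because |h| powr -(n + \<delta>) is not integrable at 0. Averaging over radii in an interval of
  length L replaces this kernel by \<open>min |h| L\<close> times it, which is integrable as 0 <
  \<delta> < 1, with integral of order L powr (1 - \<delta>); division by L leaves L powr -\<delta>.
  With p = (n - \<delta>)/n the identity n p + \<delta> = n then lets the volume outside the k-th
  ball shrink like 2 powr (-n k) while the radii grow by steps of order 2 powr -k, so their sum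
  stays bounded. The curves of the separation property need not be rectifiable; polynomial
  approximations, close relative to the boundary distance, repair this.\<close>

lemma nn_integral_lborel_translate:
  fixes f :: "'a::euclidean_space \<Rightarrow> ennreal"
  assumes [measurable]: "f \<in> borel_measurable borel"
  shows "(\<integral>\<^sup>+x. f (a + x) \<partial>lborel) = (\<integral>\<^sup>+x. f x \<partial>lborel)"
proof -
  have "(\<integral>\<^sup>+x. f x \<partial>lborel) = (\<integral>\<^sup>+x. f x \<partial>distr lborel borel ((+) a))"
    by (simp add: lborel_distr_plus)
  also have "\<dots> = (\<integral>\<^sup>+x. f (a + x) \<partial>lborel)"
    by (subst nn_integral_distr) auto
  finally show ?thesis by simp
qed

lemma nn_integral_lborel_scale:
  fixes f :: "'a::euclidean_space \<Rightarrow> ennreal"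
  assumes [measurable]: "f \<in> borel_measurable borel" and "c > 0"
  shows "(\<integral>\<^sup>+x. f x \<partial>lborel) = ennreal (c ^ DIM('a)) * (\<integral>\<^sup>+x. f (c *\<^sub>R x) \<partial>lborel)"
proof -
  have "(\<integral>\<^sup>+x. f x \<partial>lborel) = (\<integral>\<^sup>+x. f x \<partial>density (distr lborel borel (\<lambda>x. 0 + c *\<^sub>R x)) (\<lambda>_. \<bar>c\<bar>^DIM('a)))"
    using lborel_affine[of c "0::'a"] \<open>c > 0\<close> by simp
  also have "\<dots> = (\<integral>\<^sup>+x. ennreal (\<bar>c\<bar> ^ DIM('a)) * f (c *\<^sub>R x) \<partial>lborel)"
    by (subst nn_integral_density; (subst nn_integral_distr)?) auto
  also have "\<dots> = ennreal (c ^ DIM('a)) * (\<integral>\<^sup>+x. f (c *\<^sub>R x) \<partial>lborel)"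
    using \<open>c > 0\<close> by (subst nn_integral_cmult) auto
  finally show ?thesis .
qed

definition scale_energy :: "('a::euclidean_space \<Rightarrow> 'a \<Rightarrow> ennreal) \<Rightarrow> real \<Rightarrow> ennreal" where
  "scale_energy G \<rho> = (\<integral>\<^sup>+y. \<integral>\<^sup>+x. G y x * indicator {0..<\<rho>} (norm (x - y)) \<partial>lborel \<partial>lborel)"

text \<open>Split the step \<open>2k\<close> into two steps \<open>k\<close>; the second one is a translate of the first.\<close>

lemma scale_energy_halve:
  fixes G :: "'a::euclidean_space \<Rightarrow> 'a \<Rightarrow> ennreal"
  assumes [measurable]: "case_prod G \<in> borel_measurable (borel \<Otimes>\<^sub>M borel)"
    and sub: "\<And>y k. G y (y + 2 *\<^sub>R k) \<le> G y (y + k) + G (y + k) (y + 2 *\<^sub>R k)"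
  shows "scale_energy G \<rho> \<le> 2 ^ (DIM('a) + 1) * scale_energy G (\<rho> / 2)"
proof -
  have shift: "scale_energy G \<sigma> = (\<integral>\<^sup>+y. \<integral>\<^sup>+k. G y (y + k) * indicator {0..<\<sigma>} (norm k) \<partial>lborel \<partial>lborel)" for \<sigma>
    unfolding scale_energy_def
  proof (rule nn_integral_cong)
    fix y :: 'a
    show "(\<integral>\<^sup>+x. G y x * indicator {0..<\<sigma>} (norm (x - y)) \<partial>lborel)
        = (\<integral>\<^sup>+k. G y (y + k) * indicator {0..<\<sigma>} (norm k) \<partial>lborel)"
      by (subst nn_integral_lborel_translate[symmetric, of _ y]) auto
  qed
  let ?I = "\<lambda>k. indicator {0..<\<rho> / 2} (norm (k::'a)) :: ennreal"
  have 2: "(\<integral>\<^sup>+y. \<integral>\<^sup>+k. G (y + k) (y + 2 *\<^sub>R k) * ?I k \<partial>lborel \<partial>lborel) = scale_energy G (\<rho> / 2)"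
  proof -
    have "(\<integral>\<^sup>+y. \<integral>\<^sup>+k. G (y + k) (y + 2 *\<^sub>R k) * ?I k \<partial>lborel \<partial>lborel)
        = (\<integral>\<^sup>+k. \<integral>\<^sup>+y. G (k + y) ((k + y) + k) * ?I k \<partial>lborel \<partial>lborel)"
      by (subst lborel_pair.Fubini') (auto simp: scaleR_2 algebra_simps)
    also have "\<dots> = (\<integral>\<^sup>+k. \<integral>\<^sup>+y. G y (y + k) * ?I k \<partial>lborel \<partial>lborel)"
      by (rule nn_integral_cong, rule nn_integral_lborel_translate) measurable
    also have "\<dots> = scale_energy G (\<rho> / 2)"
      unfolding shift by (rule lborel_pair.Fubini') measurable
    finally show ?thesis .
  qed
  \<comment> \<open>The substitution of 2k for the step supplies the factor
    \<open>2 ^ DIM('a)\<close>; the two halves of the step supply the remaining factor 2.\<close>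
  have "scale_energy G \<rho> = (\<integral>\<^sup>+y. ennreal (2 ^ DIM('a)) * (\<integral>\<^sup>+k. G y (y + 2 *\<^sub>R k) * ?I k \<partial>lborel) \<partial>lborel)"
    unfolding shift
    by (rule nn_integral_cong, subst nn_integral_lborel_scale[where c=2]) (auto simp: indicator_def mult.commute intro!: nn_integral_cong)
  also have "\<dots> = ennreal (2 ^ DIM('a)) * (\<integral>\<^sup>+y. \<integral>\<^sup>+k. G y (y + 2 *\<^sub>R k) * ?I k \<partial>lborel \<partial>lborel)"
    by (rule nn_integral_cmult) measurable
  also have "\<dots> \<le> ennreal (2 ^ DIM('a)) * (\<integral>\<^sup>+y. \<integral>\<^sup>+k. G y (y + k) * ?I k + G (y + k) (y + 2 *\<^sub>R k) * ?I k \<partial>lborel \<partial>lborel)"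
    by (intro mult_left_mono nn_integral_mono) (auto simp: distrib_right[symmetric] intro!: mult_right_mono sub)
  also have "\<dots> = ennreal (2 ^ DIM('a)) * (scale_energy G (\<rho> / 2) + scale_energy G (\<rho> / 2))"
    by (subst nn_integral_add, measurable, subst nn_integral_add, measurable) (simp add: 2 shift[symmetric])
  also have "\<dots> = 2 ^ (DIM('a) + 1) * scale_energy G (\<rho> / 2)"
    by (simp add: mult_2[symmetric] ennreal_power[symmetric] mult.assoc mult.left_commute flip: ennreal_numeral)
  finally show ?thesis .
qed

lemma scale_energy_dyadic:
  fixes G :: "'a::euclidean_space \<Rightarrow> 'a \<Rightarrow> ennreal"
  assumes "case_prod G \<in> borel_measurable (borel \<Otimes>\<^sub>M borel)"
    and "\<And>y k. G y (y + 2 *\<^sub>R k) \<le> G y (y + k) + G (y + k) (y + 2 *\<^sub>R k)"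
  shows "scale_energy G \<rho> \<le> 2 ^ (k * (DIM('a) + 1)) * scale_energy G (\<rho> / 2 ^ k)"
proof (induction k)
  case (Suc k)
  have "scale_energy G \<rho> \<le> 2 ^ (k * (DIM('a) + 1)) * scale_energy G (\<rho> / 2 ^ k)"
    by (rule Suc)
  also have "\<dots> \<le> 2 ^ (k * (DIM('a) + 1)) * (2 ^ (DIM('a) + 1) * scale_energy G (\<rho> / 2 ^ k / 2))"
    by (intro mult_left_mono scale_energy_halve assms) auto
  finally show ?case by (simp add: power_add mult_ac)
qed simp

text \<open>The terms with R / 2 ^ k > s grow by the ratio 2 powr q, which is at least 2, so their
  sum is at most twice the last one, and that one is at most s powr -q. In the induction a new term
  either vanishes or has all earlier scales above s as well.\<close>

lemma dyadic_sum_le: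
  fixes s R q :: real
  assumes "s > 0" "R > 0" "q \<ge> 1"
  shows "(\<Sum>k<N. (R / 2 ^ k) powr -q * indicator {0..<R / 2 ^ k} s) \<le> 2 * s powr -q"
proof (induction N)
  case 0
  then show ?case by simp
next
  case (Suc N)
  have pw: "(R / 2 ^ k) powr -q = R powr -q * (2 powr q) ^ k" for k :: nat
    using assms by (simp add: powr_divide powr_minus_divide powr_realpow[symmetric] powr_powr mult.commute)
  have geo: "(\<Sum>k<N. (2 powr q) ^ k) \<le> (2 powr q) ^ N" for N
  proof (induction N)
    case (Suc N)
    have "2 powr 1 \<le> 2 powr q" using assms by (intro powr_mono) auto
    then have "2 * (2 powr q) ^ N \<le> 2 powr q * (2 powr q) ^ N" by (intro mult_right_mono) auto
    then show ?case unfolding sum.lessThan_Suc power_Suc using Suc by linarith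
  qed simp
  show ?case
  proof (cases "s < R / 2 ^ N")
    case True
    have "(\<Sum>k<Suc N. (R / 2 ^ k) powr -q * indicator {0..<R / 2 ^ k} s) \<le> (\<Sum>k<Suc N. (R / 2 ^ k) powr -q)"
      by (intro sum_mono) (auto simp: indicator_def)
    also have "\<dots> = R powr -q * (\<Sum>k<Suc N. (2 powr q) ^ k)"
      by (simp only: pw sum_distrib_left)
    also have "\<dots> \<le> R powr -q * (2 * (2 powr q) ^ N)"
      using geo[of N] by (intro mult_left_mono) auto
    also have "\<dots> = 2 * (R / 2 ^ N) powr -q" by (simp add: pw)
    also have "\<dots> \<le> 2 * s powr -q"
      using True assms by (intro mult_left_mono powr_mono2') auto
    finally show ?thesis .
  next
    case False
    with Suc show ?thesis by simp
  qed
qed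

text \<open>The ratio x = 2 powr -s satisfies 1 - x \<le> s, since exp t \<ge> 1 + t and ln 2 < 1.
  As soon as x ^ N < 1/2, the partial sum has reached half of the limit 1 / (1 - x).\<close>

lemma geometric_sum_ge:
  fixes s :: real
  assumes "0 < s" "s < 1"
  obtains N :: nat where "(\<Sum>k<N. (2 powr -s) ^ k) \<ge> 1 / (2 * s)"
proof -
  define x :: real where "x = 2 powr -s"
  have x: "0 < x" "x < 1" using assms by (auto simp: x_def powr_less_one)
  have "s * ln 2 \<le> s * 1" using assms ln_2_less_1 by (intro mult_left_mono) auto
  then have "1 - s \<le> 1 + (- s * ln 2)" by simp
  also have "\<dots> \<le> x" unfolding x_def powr_def using exp_ge_add_one_self[of "- s * ln 2"] by simp
  finally have xs: "1 - x \<le> s" by simp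
  obtain N where N: "x ^ N < 1/2" using real_arch_pow_inv[of "1/2" x] x by auto
  have "1 / (2 * s) = (1/2) / s" by simp
  also have "\<dots> \<le> (1 - x ^ N) / (1 - x)" using N xs x assms by (intro frac_le) auto
  also have "\<dots> = (\<Sum>k<N. x ^ k)" using x by (simp add: sum_gp_strict)
  finally show thesis using that x_def by blast
qed

text \<open>Summing the dyadic estimates gives a geometric series with ratio \<open>2 powr (\<delta> - 1)\<close>;
  its size \<open>1 / (1 - \<delta>)\<close> is the source of the factor \<open>1 - \<delta>\<close>.\<close>

lemma scale_energy_le_singular:
  fixes G :: "'a::euclidean_space \<Rightarrow> 'a \<Rightarrow> ennreal"
  assumes [measurable]: "case_prod G \<in> borel_measurable (borel \<Otimes>\<^sub>M borel)"
    and sub: "\<And>y k. G y (y + 2 *\<^sub>R k) \<le> G y (y + k) + G (y + k) (y + 2 *\<^sub>R k)"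
    and diag: "\<And>y. G y y = 0"
    and \<delta>: "0 < \<delta>" "\<delta> < 1" and "R > 0"
  shows "scale_energy G R * ennreal (R powr - (real DIM('a) + \<delta>))
    \<le> ennreal (4 * (1 - \<delta>)) * (\<integral>\<^sup>+y. \<integral>\<^sup>+x. G y x * ennreal (1 / norm (x - y) powr (real DIM('a) + \<delta>)) \<partial>lborel \<partial>lborel)"
proof -
  define n where "n = DIM('a)"
  define q where "q = real n + \<delta>"
  have "n \<ge> 1" using DIM_positive[where 'a='a] by (simp add: n_def Suc_le_eq)
  then have q: "q \<ge> 1" using \<delta> by (simp add: q_def)
  define P where "P = (\<integral>\<^sup>+y. \<integral>\<^sup>+x. G y x * ennreal (1 / norm (x - y) powr q) \<partial>lborel \<partial>lborel)"
  obtain N :: nat where N: "(\<Sum>k<N. (2 powr - (1 - \<delta>)) ^ k) \<ge> 1 / (2 * (1 - \<delta>))"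
    using geometric_sum_ge[of "1 - \<delta>"] \<delta> by auto
  have 1: "ennreal (R powr -q * (2 powr - (1 - \<delta>)) ^ k) * scale_energy G R
      \<le> ennreal ((R / 2 ^ k) powr -q) * scale_energy G (R / 2 ^ k)" for k :: nat
  proof -
    have "(R / 2 ^ k) powr -q = R powr -q * 2 powr (real k * q)"
      using \<open>R > 0\<close> by (simp add: powr_divide powr_minus_divide powr_realpow[symmetric] powr_powr)
    \<comment> \<open>The exponent q = n + \<delta> falls short of the n + 1 lost per halving by
      exactly 1 - \<delta>; this difference becomes the ratio of the series.\<close>
    also have "2 powr (real k * q) = 2 powr (real k * real (n + 1)) * 2 powr (- (real k * (1 - \<delta>)))"
    proof -
      have "real k * q = real k * real (n + 1) + - (real k * (1 - \<delta>))" by (simp add: q_def algebra_simps)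
      then show ?thesis by (simp only: powr_add)
    qed
    also have "2 powr (real k * real (n + 1)) = 2 ^ (k * (n + 1))"
      by (subst powr_realpow[symmetric]) (auto simp: algebra_simps)
    also have "2 powr (- (real k * (1 - \<delta>))) = (2 powr - (1 - \<delta>)) ^ k"
    proof -
      have "(2 powr - (1 - \<delta>)) ^ k = (2 powr - (1 - \<delta>)) powr real k"
        by (rule powr_realpow[symmetric]) simp
      also have "\<dots> = 2 powr (- (1 - \<delta>) * real k)" by (rule powr_powr)
      also have "- (1 - \<delta>) * real k = - (real k * (1 - \<delta>))" by (simp add: algebra_simps)
      finally show ?thesis by (rule sym)
    qed
    finally have e: "(R / 2 ^ k) powr -q = R powr -q * (2 powr - (1 - \<delta>)) ^ k * 2 ^ (k * (n + 1))"
      by (simp only: mult_ac)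
    have "ennreal (R powr -q * (2 powr - (1 - \<delta>)) ^ k) * scale_energy G R
      \<le> ennreal (R powr -q * (2 powr - (1 - \<delta>)) ^ k) * (2 ^ (k * (n + 1)) * scale_energy G (R / 2 ^ k))"
      unfolding n_def by (intro mult_left_mono scale_energy_dyadic sub assms) auto
    also have "\<dots> = ennreal ((R / 2 ^ k) powr -q) * scale_energy G (R / 2 ^ k)"
    proof -
      have "(2::ennreal) ^ j = ennreal (2 ^ j)" for j :: nat
        using ennreal_power[of 2 j] by simp
      then show ?thesis
        unfolding e by (simp only: mult.assoc[symmetric], subst ennreal_mult[symmetric]) auto
    qed
    finally show ?thesis .
  qed
  have "ennreal (1 / (2 * (1 - \<delta>))) * (scale_energy G R * ennreal (R powr -q))
      \<le> ennreal (\<Sum>k<N. (2 powr - (1 - \<delta>)) ^ k) * (scale_energy G R * ennreal (R powr -q))"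
    by (intro mult_right_mono ennreal_leI N) auto
  also have "\<dots> = (\<Sum>k<N. ennreal (R powr -q * (2 powr - (1 - \<delta>)) ^ k) * scale_energy G R)"
  proof -
    have "(\<Sum>k<N. ennreal (R powr -q * (2 powr - (1 - \<delta>)) ^ k) * scale_energy G R)
        = (\<Sum>k<N. ennreal ((2 powr - (1 - \<delta>)) ^ k) * (scale_energy G R * ennreal (R powr -q)))"
      by (rule sum.cong[OF refl], subst ennreal_mult) (auto simp: mult_ac)
    then show ?thesis by (simp only: sum_distrib_right[symmetric]) (simp add: sum_ennreal)
  qed
  also have "\<dots> \<le> (\<Sum>k<N. ennreal ((R / 2 ^ k) powr -q) * scale_energy G (R / 2 ^ k))"
    by (intro sum_mono 1)
  also have "\<dots> = (\<integral>\<^sup>+y. \<integral>\<^sup>+x. (\<Sum>k<N. ennreal ((R / 2 ^ k) powr -q) * (G y x * indicator {0..<R / 2 ^ k} (norm (x - y)))) \<partial>lborel \<partial>lborel)"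
    unfolding scale_energy_def
    by (subst nn_integral_sum, measurable, subst nn_integral_sum, measurable) (simp add: nn_integral_cmult)
  also have "\<dots> \<le> (\<integral>\<^sup>+y. \<integral>\<^sup>+x. 2 * (G y x * ennreal (1 / norm (x - y) powr q)) \<partial>lborel \<partial>lborel)"
  proof (intro nn_integral_mono)
    fix x y :: 'a
    show "(\<Sum>k<N. ennreal ((R / 2 ^ k) powr -q) * (G y x * indicator {0..<R / 2 ^ k} (norm (x - y))))
        \<le> 2 * (G y x * ennreal (1 / norm (x - y) powr q))"
    \<comment> \<open>On the diagonal the right side is 0 because \<open>1 / 0 = 0\<close>, so the
      left side has to vanish there too; this is what \<open>diag\<close> provides.\<close>
    proof (cases "x = y")
      case False
      have "(\<Sum>k<N. ennreal ((R / 2 ^ k) powr -q) * (G y x * indicator {0..<R / 2 ^ k} (norm (x - y))))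
          = G y x * ennreal (\<Sum>k<N. (R / 2 ^ k) powr -q * indicator {0..<R / 2 ^ k} (norm (x - y)))"
      proof -
        have "ennreal ((R / 2 ^ k) powr -q) * (G y x * indicator {0..<R / 2 ^ k} (norm (x - y)))
          = G y x * ennreal ((R / 2 ^ k) powr -q * indicator {0..<R / 2 ^ k} (norm (x - y)))" for k :: nat
          by (subst ennreal_mult) (auto simp: ennreal_indicator mult_ac)
        then show ?thesis by (simp only: sum_distrib_left[symmetric]) (simp add: sum_ennreal)
      qed
      also have "\<dots> \<le> G y x * ennreal (2 * norm (x - y) powr -q)"
        using False q \<open>R > 0\<close> by (intro mult_left_mono ennreal_leI dyadic_sum_le) auto
      also have "\<dots> = 2 * (G y x * ennreal (1 / norm (x - y) powr q))"
      proof -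
        have "ennreal (2 * norm (x - y) powr -q) = 2 * ennreal (1 / norm (x - y) powr q)"
          by (simp only: powr_minus_divide) (subst ennreal_mult, auto)
        then show ?thesis by (simp only: mult_ac)
      qed
      finally show ?thesis .
    qed (simp add: diag)
  qed
  also have "\<dots> = 2 * P"
    unfolding P_def by (simp add: nn_integral_cmult)
  finally have "ennreal (2 * (1 - \<delta>)) * (ennreal (1 / (2 * (1 - \<delta>))) * (scale_energy G R * ennreal (R powr -q)))
      \<le> ennreal (2 * (1 - \<delta>)) * (2 * P)" by (rule mult_left_mono) simp
  moreover have "ennreal (2 * (1 - \<delta>)) * (ennreal (1 / (2 * (1 - \<delta>))) * X) = X" for X
    using \<delta> by (simp add: mult.assoc[symmetric] ennreal_mult[symmetric])
  moreover have "ennreal (2 * (1 - \<delta>)) * (2 * P) = ennreal (4 * (1 - \<delta>)) * P"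
  proof -
    have "ennreal (4 * (1 - \<delta>)) = ennreal (2 * (1 - \<delta>)) * ennreal 2"
      using \<delta> by (subst ennreal_mult[symmetric]) auto
    then show ?thesis by (simp add: mult.assoc)
  qed
  ultimately show ?thesis by (simp add: P_def q_def n_def)
qed

text \<open>Any two points of the ball are less than 2r apart, so the energy at scale 2r is at least
  the product of the volumes of the two halves, (\<omega> r^n / 2)^2. In the constant, one 4 is the
  square of this 2, the other 4 comes from \<open>scale_energy_le_singular\<close>, and 2 ^ (n + 1)
  bounds the 2 powr q produced by the scale 2r, uniformly in \<delta>.\<close>

lemma relative_isoperimetric_ball:
  fixes U :: "'a::euclidean_space set"
  assumes [measurable]: "U \<in> sets borel" and "r > 0" and \<delta>: "0 < \<delta>" "\<delta> < 1"
    and half: "measure lborel (U \<inter> ball z r) = measure lborel (ball z r) / 2"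
  shows "ennreal (r powr (real DIM('a) - \<delta>)) \<le>
    ennreal (16 * 2 ^ (DIM('a) + 1) / (unit_ball_vol (real DIM('a)))\<^sup>2 * (1 - \<delta>)) *
    (\<integral>\<^sup>+y\<in>ball z r. (\<integral>\<^sup>+x\<in>ball z r. ennreal (\<bar>indicator U x - indicator U y\<bar> / norm (x - y) powr (real DIM('a) + \<delta>)) \<partial>lborel) \<partial>lborel)"
    (is "_ \<le> _ * ?P")
proof -
  define n where "n = DIM('a)"
  define q where "q = real n + \<delta>"
  define \<omega> where "\<omega> = unit_ball_vol (real n)"
  have \<omega>: "\<omega> > 0" by (simp add: \<omega>_def)
  let ?B = "ball z r"
  define G :: "'a \<Rightarrow> 'a \<Rightarrow> ennreal" where
    "G y x = ennreal \<bar>indicator U x - indicator U y\<bar> * indicator ?B x * indicator ?B y" for y x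
  have [measurable]: "?B \<in> sets borel" by simp
  have G_meas[measurable]: "case_prod G \<in> borel_measurable (borel \<Otimes>\<^sub>M borel)"
    unfolding G_def by measurable
  \<comment> \<open>Convexity keeps the midpoint in the ball, where the differences of indicators
    obey the triangle inequality.\<close>
  have sub: "G y (y + 2 *\<^sub>R k) \<le> G y (y + k) + G (y + k) (y + 2 *\<^sub>R k)" for y k
  proof (cases "y \<in> ?B \<and> y + 2 *\<^sub>R k \<in> ?B")
    case True
    have "y + k = (1/2) *\<^sub>R y + (1/2) *\<^sub>R (y + 2 *\<^sub>R k)"
      by (simp add: scaleR_add_right flip: scaleR_add_left)
    also have "\<dots> \<in> ?B"
      using True convexD[OF convex_ball, of y z r "y + 2 *\<^sub>R k" "1/2" "1/2"] by auto
    finally have "y + k \<in> ?B" .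
    with True show ?thesis
      by (auto simp: G_def indicator_def)
  qed (auto simp: G_def)
  have "emeasure lborel ?B = ennreal (\<omega> * r ^ n)"
    using emeasure_ball[of r z] \<open>r > 0\<close> by (simp add: \<omega>_def n_def)
  then have mB: "measure lborel ?B = \<omega> * r ^ n" and fB: "?B \<in> fmeasurable lborel"
    using \<omega> \<open>r > 0\<close> by (auto simp: measure_def fmeasurable_def)
  have fU: "U \<inter> ?B \<in> fmeasurable lborel"
    by (rule fmeasurableI2[OF fB]) auto
  have "measure lborel (?B - U) = measure lborel ?B - measure lborel (U \<inter> ?B)"
    using measurable_measure_Diff[OF fB, of "U \<inter> ?B"] by (simp add: Diff_Int2 Int_commute Diff_Int)
  with half have half': "measure lborel (?B - U) = \<omega> * r ^ n / 2" by (simp add: mB)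
  have em: "emeasure lborel (U \<inter> ?B) = ennreal (\<omega> * r ^ n / 2)" "emeasure lborel (?B - U) = ennreal (\<omega> * r ^ n / 2)"
    using emeasure_eq_measure2[OF fU] emeasure_eq_measure2[OF fmeasurable_Diff[OF fB, of U]]
    unfolding half half' mB by auto
  have "ennreal ((\<omega> * r ^ n / 2)\<^sup>2) = (\<integral>\<^sup>+y. indicator (U \<inter> ?B) y * emeasure lborel (?B - U) \<partial>lborel)"
    using \<omega> \<open>r > 0\<close> by (simp add: nn_integral_multc em power2_eq_square ennreal_mult[symmetric])
  also have "\<dots> = (\<integral>\<^sup>+y. \<integral>\<^sup>+x. indicator (U \<inter> ?B) y * indicator (?B - U) x \<partial>lborel \<partial>lborel)"
    by (simp add: nn_integral_cmult)
  also have "\<dots> \<le> scale_energy G (2 * r)"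
    unfolding scale_energy_def
  proof (intro nn_integral_mono)
    fix x y :: 'a
    have "norm (x - y) < 2 * r" if "x \<in> ?B" "y \<in> ?B"
      using that dist_triangle2[of x y z] by (simp add: dist_norm[symmetric] dist_commute)
    then show "indicator (U \<inter> ?B) y * indicator (?B - U) x \<le> G y x * indicator {0..<2 * r} (norm (x - y))"
      unfolding G_def by (auto simp: indicator_def)
  qed
  finally have "ennreal ((\<omega> * r ^ n / 2)\<^sup>2) * ennreal ((2 * r) powr -q) \<le> scale_energy G (2 * r) * ennreal ((2 * r) powr -q)"
    by (rule mult_right_mono) simp
  also have "\<dots> \<le> ennreal (4 * (1 - \<delta>)) * (\<integral>\<^sup>+y. \<integral>\<^sup>+x. G y x * ennreal (1 / norm (x - y) powr q) \<partial>lborel \<partial>lborel)"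
    unfolding q_def n_def using \<delta> \<open>r > 0\<close> by (intro scale_energy_le_singular G_meas sub) (auto simp: G_def)
  also have "(\<integral>\<^sup>+y. \<integral>\<^sup>+x. G y x * ennreal (1 / norm (x - y) powr q) \<partial>lborel \<partial>lborel) = ?P"
  proof (rule nn_integral_cong)
    fix y :: 'a
    have "G y x * ennreal (1 / norm (x - y) powr q)
        = ennreal (\<bar>indicator U x - indicator U y\<bar> / norm (x - y) powr (real DIM('a) + \<delta>)) * indicator ?B x * indicator ?B y" for x
      by (simp add: G_def q_def n_def ennreal_mult[symmetric] mult_ac split: split_indicator)
    then show "(\<integral>\<^sup>+x. G y x * ennreal (1 / norm (x - y) powr q) \<partial>lborel)
        = (\<integral>\<^sup>+x\<in>?B. ennreal (\<bar>indicator U x - indicator U y\<bar> / norm (x - y) powr (real DIM('a) + \<delta>)) \<partial>lborel) * indicator ?B y"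
      by (simp add: nn_integral_multc)
  qed
  finally have *: "ennreal ((\<omega> * r ^ n / 2)\<^sup>2 * (2 * r) powr -q) \<le> ennreal (4 * (1 - \<delta>)) * ?P"
    by (simp add: ennreal_mult)
  define c where "c = 4 * 2 powr q / \<omega>\<^sup>2"
  have "(\<omega> * r ^ n / 2)\<^sup>2 * (2 * r) powr -q = \<omega>\<^sup>2 / (4 * 2 powr q) * (r ^ n * r ^ n * r powr -q)"
    using \<open>r > 0\<close> by (simp add: power2_eq_square powr_mult powr_minus_divide[of 2])
  also have "r ^ n * r ^ n * r powr -q = r powr (real n - \<delta>)"
    using \<open>r > 0\<close> by (simp add: powr_realpow[symmetric] powr_add[symmetric] q_def)
  finally have c: "r powr (real n - \<delta>) = c * ((\<omega> * r ^ n / 2)\<^sup>2 * (2 * r) powr -q)"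
    using \<omega> by (simp add: c_def)
  have "ennreal (r powr (real n - \<delta>)) = ennreal c * ennreal ((\<omega> * r ^ n / 2)\<^sup>2 * (2 * r) powr -q)"
    unfolding c by (rule ennreal_mult) (auto simp: c_def)
  also have "\<dots> \<le> ennreal c * (ennreal (4 * (1 - \<delta>)) * ?P)"
    by (intro mult_left_mono *) simp
  also have "\<dots> = ennreal (c * (4 * (1 - \<delta>))) * ?P"
    using \<delta> by (subst ennreal_mult) (auto simp: mult.assoc c_def)
  also have "\<dots> \<le> ennreal (16 * 2 ^ (n + 1) / \<omega>\<^sup>2 * (1 - \<delta>)) * ?P"
  proof (intro mult_right_mono ennreal_leI)
    have "2 powr q \<le> 2 powr real (n + 1)" using \<delta> unfolding q_def by (intro powr_mono) auto
    also have "\<dots> = 2 ^ (n + 1)" by (subst powr_realpow) auto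
    finally have "4 * (1 - \<delta>) * (4 * 2 powr q / \<omega>\<^sup>2) \<le> 4 * (1 - \<delta>) * (4 * 2 ^ (n + 1) / \<omega>\<^sup>2)"
      using \<delta> by (intro mult_left_mono divide_right_mono) auto
    moreover have "c * (4 * (1 - \<delta>)) = 4 * (1 - \<delta>) * (4 * 2 powr q / \<omega>\<^sup>2)" by (simp add: c_def)
    moreover have "16 * 2 ^ (n + 1) / \<omega>\<^sup>2 * (1 - \<delta>) = 4 * (1 - \<delta>) * (4 * 2 ^ (n + 1) / \<omega>\<^sup>2)" by simp
    ultimately show "c * (4 * (1 - \<delta>)) \<le> 16 * 2 ^ (n + 1) / \<omega>\<^sup>2 * (1 - \<delta>)" by linarith
  qed simp
  finally show ?thesis by (simp add: n_def \<omega>_def)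
qed

subsection \<open>Points of density one half\<close>

lemma measure_lborel_ball:
  "0 \<le> r \<Longrightarrow> measure lborel (ball (z::'a::euclidean_space) r) = unit_ball_vol (real DIM('a)) * r ^ DIM('a)"
  using emeasure_ball[of r z] by (simp add: measure_def)

lemma ball_fmeasurable_lborel: "ball (z::'a::euclidean_space) r \<in> fmeasurable lborel"
  using emeasure_lborel_ball_finite[of z r] by (simp add: fmeasurable_def less_top)

text \<open>The second ball lies in a ball about z of radius max r (dist z z' + r'), so it can gain
  volume only in the shell around \<open>ball z r\<close>. Exchanging the two balls gives the
  opposite bound, and both shells shrink to nothing as centre and radius converge; this is the
  continuity used below.\<close>

lemma measure_Int_ball_diff_le:
  fixes U :: "'a::euclidean_space set"
  assumes [measurable]: "U \<in> sets borel" and "0 \<le> r"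
  shows "measure lborel (U \<inter> ball z' r') - measure lborel (U \<inter> ball z r)
    \<le> unit_ball_vol (real DIM('a)) * (max r (dist z z' + r') ^ DIM('a) - r ^ DIM('a))"
proof -
  define s where "s = max r (dist z z' + r')"
  have s: "r \<le> s" "dist z z' + r' \<le> s" by (auto simp: s_def)
  have "U \<inter> ball z' r' \<subseteq> ball z s"
  proof
    fix x assume "x \<in> U \<inter> ball z' r'"
    then have "dist z x < dist z z' + r'" using dist_triangle[of z x z'] by simp
    then show "x \<in> ball z s" using s(2) by simp
  qed
  then have "U \<inter> ball z' r' \<subseteq> (U \<inter> ball z r) \<union> (ball z s - ball z r)" by auto
  then have "measure lborel (U \<inter> ball z' r') \<le> measure lborel ((U \<inter> ball z r) \<union> (ball z s - ball z r))"
    by (intro measure_mono_fmeasurable fmeasurable.Un fmeasurable_Diff ball_fmeasurable_lborel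
        fmeasurableI2[OF ball_fmeasurable_lborel[of z r]]) auto
  also have "\<dots> \<le> measure lborel (U \<inter> ball z r) + measure lborel (ball z s - ball z r)"
    by (rule measure_Un_le) auto
  also have "measure lborel (ball z s - ball z r) = measure lborel (ball z s) - measure lborel (ball z r)"
    using s by (intro measurable_measure_Diff ball_fmeasurable_lborel subset_ball) auto
  also have "\<dots> = unit_ball_vol (real DIM('a)) * (s ^ DIM('a) - r ^ DIM('a))"
    using s \<open>r \<ge> 0\<close> by (simp add: measure_lborel_ball algebra_simps)
  finally show ?thesis by (simp add: s_def)
qed

lemma continuous_on_measure_Int_ball:
  fixes U :: "'a::euclidean_space set" and S :: "'b::metric_space set"
  assumes U: "U \<in> sets borel" and z: "continuous_on S z" and r: "continuous_on S r"
    and nonneg: "\<And>t. t \<in> S \<Longrightarrow> 0 \<le> r t"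
  shows "continuous_on S (\<lambda>t. measure lborel (U \<inter> ball (z t) (r t)))"
  unfolding continuous_on_def
proof
  fix t assume t: "t \<in> S"
  let ?\<omega> = "unit_ball_vol (real DIM('a))" and ?n = "DIM('a)"
  let ?m = "\<lambda>t. measure lborel (U \<inter> ball (z t) (r t))"
  let ?e = "\<lambda>u. ?\<omega> * (max (r t) (dist (z t) (z u) + r u) ^ ?n - r t ^ ?n)"
  let ?e' = "\<lambda>u. ?\<omega> * (max (r u) (dist (z u) (z t) + r t) ^ ?n - r u ^ ?n)"
  have zt: "(z \<longlongrightarrow> z t) (at t within S)" and rt: "(r \<longlongrightarrow> r t) (at t within S)"
    using z r t by (auto simp: continuous_on_def)
  have "(?e \<longlongrightarrow> ?\<omega> * (max (r t) (dist (z t) (z t) + r t) ^ ?n - r t ^ ?n)) (at t within S)"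
    by (intro tendsto_intros zt rt)
  then have e: "(?e \<longlongrightarrow> 0) (at t within S)" by simp
  have "(?e' \<longlongrightarrow> ?\<omega> * (max (r t) (dist (z t) (z t) + r t) ^ ?n - r t ^ ?n)) (at t within S)"
    by (intro tendsto_intros zt rt)
  then have e': "(?e' \<longlongrightarrow> 0) (at t within S)" by simp
  have lim: "((\<lambda>u. ?m t - ?e' u) \<longlongrightarrow> ?m t) (at t within S)" "((\<lambda>u. ?m t + ?e u) \<longlongrightarrow> ?m t) (at t within S)"
    using tendsto_diff[OF tendsto_const e', of "?m t"] tendsto_add[OF tendsto_const e, of "?m t"]
    unfolding add_0_right diff_0_right by auto
  have ev: "\<forall>\<^sub>F u in at t within S. u \<in> S" by (simp add: eventually_at_filter)
  show "(?m \<longlongrightarrow> ?m t) (at t within S)"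
  proof (rule tendsto_sandwich)
    show "\<forall>\<^sub>F u in at t within S. ?m t - ?e' u \<le> ?m u"
      using ev
    proof eventually_elim
      case (elim u)
      show ?case using measure_Int_ball_diff_le[OF U nonneg[OF elim], of "z t" "r t" "z u"] by simp
    qed
    show "\<forall>\<^sub>F u in at t within S. ?m u \<le> ?m t + ?e u"
      using ev
    proof eventually_elim
      case (elim u)
      show ?case using measure_Int_ball_diff_le[OF U nonneg[OF t], of "z u" "r u" "z t"] by simp
    qed
  qed (use lim in auto)
qed

lemma half_density_on_path:
  fixes U :: "'a::euclidean_space set" and z :: "real \<Rightarrow> 'a"
  assumes U: "U \<in> sets borel" and "a \<le> b"
    and z: "continuous_on {a..b} z" and r: "continuous_on {a..b} r" and pos: "\<And>t. t \<in> {a..b} \<Longrightarrow> 0 \<le> r t"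
    and a: "measure lborel (U \<inter> ball (z a) (r a)) \<ge> measure lborel (ball (z a) (r a)) / 2"
    and b: "measure lborel (U \<inter> ball (z b) (r b)) \<le> measure lborel (ball (z b) (r b)) / 2"
  shows "\<exists>t\<in>{a..b}. measure lborel (U \<inter> ball (z t) (r t)) = measure lborel (ball (z t) (r t)) / 2"
proof -
  \<comment> \<open>The volume of the ball itself is written with \<open>UNIV\<close> so that the
    same continuity lemma covers both terms.\<close>
  let ?f = "\<lambda>t. measure lborel (U \<inter> ball (z t) (r t)) - measure lborel (UNIV \<inter> ball (z t) (r t)) / 2"
  have "continuous_on {a..b} ?f"
    by (intro continuous_intros continuous_on_measure_Int_ball U z r pos) auto
  then have "\<exists>t. a \<le> t \<and> t \<le> b \<and> ?f t = 0"
    using a b \<open>a \<le> b\<close> by (intro IVT2') auto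
  then show ?thesis by auto
qed

text \<open>Only rational multiples of \<open>\<rho> x\<close> are used as radii, so that the exceptional set is Borel.
  If the density were below one half at all these radii, Vitali's theorem would cover the set by
  balls in which it has density at most one half, inside any open neighbourhood of it.\<close>

lemma half_density_AE:
  fixes U :: "'a::euclidean_space set" and \<rho> :: "'a \<Rightarrow> real"
  assumes U: "U \<in> sets borel" "bounded U" and \<rho>: "continuous_on UNIV \<rho>" "\<And>x. x \<in> U \<Longrightarrow> \<rho> x > 0" "\<And>x. 0 \<le> \<rho> x"
  obtains N where "N \<in> null_sets lborel" "N \<subseteq> U"
    "\<forall>x\<in>U - N. \<exists>s\<in>{0<..\<rho> x}. measure lborel (U \<inter> ball x s) \<ge> measure lborel (ball x s) / 2"
proof -
  define Q where "Q = {0<..1} \<inter> (\<rat>::real set)"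
  have Qc: "countable Q" unfolding Q_def using countable_rat by auto
  define bad where "bad q = {x. measure lborel (U \<inter> ball x (q * \<rho> x)) < measure lborel (UNIV \<inter> ball x (q * \<rho> x)) / 2}" for q
  define N where "N = U \<inter> (\<Inter>q\<in>Q. bad q)"
  have "open (bad q)" if "q \<in> Q" for q
    unfolding bad_def
    using that \<rho> U(1) by (intro open_Collect_less continuous_intros continuous_on_measure_Int_ball) (auto simp: Q_def)
  then have N: "N \<in> sets borel"
    unfolding N_def using U(1) Qc by (intro sets.Int sets.countable_INT'') auto
  have Nf: "N \<in> lmeasurable"
    using N bounded_subset[OF U(2), of N] by (intro bounded_set_imp_lmeasurable) (auto simp: N_def)
  have "measure lebesgue N \<le> 0"
  proof (rule ccontr)
    assume "\<not> measure lebesgue N \<le> 0"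
    then have pos: "measure lebesgue N > 0" by simp
    \<comment> \<open>W exceeds N by less than the volume of N, so |W| < 2 |N|. A disjoint cover of
      almost all of N by balls in W with density at most one half will give |N| \<le> |W| / 2, a
      contradiction.\<close>
    obtain W where W: "open W" "N \<subseteq> W" "W - N \<in> lmeasurable" "emeasure lebesgue (W - N) < ennreal (measure lebesgue N)"
      by (rule sets_lebesgue_outer_open[OF fmeasurableD[OF Nf] pos])
    have Wm: "W \<in> lmeasurable"
      using fmeasurable.Un[OF W(3) Nf] W(2) by (simp add: Un_absorb2)
    have "measure lebesgue W \<le> measure lebesgue N + measure lebesgue (W - N)"
      using measure_Un_le[OF fmeasurableD[OF Nf] fmeasurableD[OF W(3)]] W(2) by (simp add: Un_absorb1)
    moreover have "measure lebesgue (W - N) < measure lebesgue N"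
      using W(4) emeasure_eq_measure2[OF W(3)] by (simp add: ennreal_less_iff)
    ultimately have W4: "measure lebesgue W < measure lebesgue N + measure lebesgue N" by simp
    define K where "K = {(x, s). x \<in> N \<and> 0 < s \<and> ball x s \<subseteq> W \<and> measure lborel (U \<inter> ball x s) \<le> measure lborel (ball x s) / 2}"
    have cover: "\<exists>i. i \<in> K \<and> x \<in> ball (fst i) (snd i) \<and> snd i < d" if x: "x \<in> N" and d: "d > 0" for x d
    proof -
      obtain e where e: "e > 0" "ball x e \<subseteq> W" using W x open_contains_ball by (metis subsetD)
      have "\<rho> x > 0" using x \<rho> N_def by auto
      obtain q where q: "q \<in> \<rat>" "0 < q" "q < min 1 (min d e / \<rho> x)"
        using Rats_dense_in_real[of 0 "min 1 (min d e / \<rho> x)"] d e \<open>\<rho> x > 0\<close> by auto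
      then have "q \<in> Q" by (auto simp: Q_def)
      then have "x \<in> bad q" using x by (auto simp: N_def)
      moreover have "q * \<rho> x < d" "q * \<rho> x < e" "0 < q * \<rho> x" using q \<open>\<rho> x > 0\<close> by (auto simp: field_simps)
      ultimately have "(x, q * \<rho> x) \<in> K" using e(2) x by (auto simp: K_def bad_def)
      then show ?thesis using \<open>q * \<rho> x < d\<close> \<open>0 < q * \<rho> x\<close> by (intro exI[of _ "(x, q * \<rho> x)"]) auto
    qed
    obtain C where C: "countable C" "C \<subseteq> K"
        "pairwise (\<lambda>i j. disjnt (ball (fst i) (snd i)) (ball (fst j) (snd j))) C"
        "negligible (N - (\<Union>i\<in>C. ball (fst i) (snd i)))"
      by (rule Vitali_covering_theorem_balls[of N K fst snd, OF cover])
    let ?B = "\<lambda>i. ball (fst i) (snd i) :: 'a set"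
    have disj: "disjoint_family_on (\<lambda>i. U \<inter> ?B i) C" "disjoint_family_on ?B C"
      using C(3) unfolding disjoint_family_on_def pairwise_def disjnt_def by blast+
    have subW: "(\<Union>i\<in>C. ?B i) \<subseteq> W" using C(2) by (fastforce simp: K_def)
    have rest: "N - (\<Union>i\<in>C. ?B i) \<in> sets lebesgue"
      using C(4) by (rule negligible_imp_sets)
    have UB: "U \<inter> ?B i \<in> sets lebesgue" for i
      using U(1) by auto
    have UN: "(\<Union>i\<in>C. U \<inter> ?B i) \<in> sets lebesgue"
      using UB by (intro sets.countable_UN'[OF C(1)]) blast
    have "N \<subseteq> (N - (\<Union>i\<in>C. ?B i)) \<union> (\<Union>i\<in>C. U \<inter> ?B i)"
      unfolding N_def by blast
    then have "emeasure lebesgue N \<le> emeasure lebesgue ((N - (\<Union>i\<in>C. ?B i)) \<union> (\<Union>i\<in>C. U \<inter> ?B i))"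
      by (rule emeasure_mono) (rule sets.Un[OF rest UN])
    also have "\<dots> \<le> emeasure lebesgue (N - (\<Union>i\<in>C. ?B i)) + emeasure lebesgue (\<Union>i\<in>C. U \<inter> ?B i)"
      by (rule emeasure_subadditive[OF rest UN])
    also have "emeasure lebesgue (N - (\<Union>i\<in>C. ?B i)) = 0"
      using C(4) unfolding negligible_iff_null_sets by (rule null_setsD1)
    also have "emeasure lebesgue (\<Union>i\<in>C. U \<inter> ?B i) = (\<integral>\<^sup>+i. emeasure lebesgue (U \<inter> ?B i) \<partial>count_space C)"
      by (rule emeasure_UN_countable[OF UB C(1) disj(1)])
    also have "\<dots> \<le> (\<integral>\<^sup>+i. ennreal (1/2) * emeasure lebesgue (?B i) \<partial>count_space C)"
    proof (intro nn_integral_mono)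
      fix i assume "i \<in> space (count_space C)"
      then have "i \<in> K" using C by auto
      then have "measure lborel (U \<inter> ?B i) \<le> 1/2 * measure lborel (?B i)" by (auto simp: K_def)
      moreover have "U \<inter> ?B i \<in> fmeasurable lborel"
        using U(1) by (intro fmeasurableI2[OF ball_fmeasurable_lborel[of "fst i" "snd i"]]) auto
      ultimately show "emeasure lebesgue (U \<inter> ?B i) \<le> ennreal (1/2) * emeasure lebesgue (?B i)"
        using ennreal_leI[of "measure lborel (U \<inter> ?B i)" "1/2 * measure lborel (?B i)"] U(1)
          emeasure_eq_measure2[of "U \<inter> ?B i" lborel] emeasure_eq_measure2[OF ball_fmeasurable_lborel[of "fst i" "snd i"]]
        by (subst (asm) ennreal_mult) auto
    qed
    also have "\<dots> = ennreal (1/2) * (\<integral>\<^sup>+i. emeasure lebesgue (?B i) \<partial>count_space C)"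
      by (intro nn_integral_cmult) auto
    also have "(\<integral>\<^sup>+i. emeasure lebesgue (?B i) \<partial>count_space C) = emeasure lebesgue (\<Union>i\<in>C. ?B i)"
      by (rule emeasure_UN_countable[OF _ C(1) disj(2), symmetric]) simp
    also have "ennreal (1/2) * emeasure lebesgue (\<Union>i\<in>C. ?B i) \<le> ennreal (1/2) * emeasure lebesgue W"
      using subW fmeasurableD[OF Wm] by (intro mult_left_mono emeasure_mono) auto
    finally have "emeasure lebesgue N \<le> ennreal (1/2) * emeasure lebesgue W" unfolding add_0_left .
    then have "ennreal (measure lebesgue N) \<le> ennreal (1/2 * measure lebesgue W)"
      unfolding emeasure_eq_measure2[OF Nf] emeasure_eq_measure2[OF Wm] by (subst ennreal_mult) auto
    then have "measure lebesgue N \<le> 1/2 * measure lebesgue W"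
      by (subst (asm) ennreal_le_iff) auto
    then show False using W4 by linarith
  qed
  then have "emeasure lebesgue N = 0" unfolding emeasure_eq_measure2[OF Nf] by (rule ennreal_neg)
  then have "N \<in> null_sets lborel" using N by (intro null_setsI) auto
  moreover have "\<forall>x\<in>U - N. \<exists>s\<in>{0<..\<rho> x}. measure lborel (U \<inter> ball x s) \<ge> measure lborel (ball x s) / 2"
  proof
    fix x assume x: "x \<in> U - N"
    obtain q where "q \<in> Q" "x \<notin> bad q" using x by (auto simp: N_def)
    moreover have "q * \<rho> x \<le> 1 * \<rho> x" "0 < q * \<rho> x"
      using \<open>q \<in> Q\<close> \<rho>(2)[of x] x by (auto simp: Q_def intro!: mult_right_mono)
    ultimately show "\<exists>s\<in>{0<..\<rho> x}. measure lborel (U \<inter> ball x s) \<ge> measure lborel (ball x s) / 2"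
      by (intro bexI[of _ "q * \<rho> x"]) (auto simp: bad_def)
  qed
  moreover have "N \<subseteq> U" by (auto simp: N_def)
  ultimately show thesis by (intro that)
qed

subsection \<open>Boxing covers\<close>

text \<open>\<open>nn_integral_completion\<close> asks for no measurability of the integrand, so the
  passage from \<open>lebesgue\<close> to \<open>lborel\<close> is available for arbitrary U and
  \<Omega>.\<close>

lemma frac_perimeter_lborel:
  "frac_perimeter \<delta> \<tau> U \<Omega> =
     (\<integral>\<^sup>+y\<in>\<Omega>. (\<integral>\<^sup>+x\<in>{x \<in> \<Omega>. norm (x - y) < \<tau> * bdry_dist \<Omega> y}.
        ennreal (\<bar>indicator U x - indicator U y\<bar> / norm (x - y) powr (real CARD('n) + \<delta>)) \<partial>lborel) \<partial>lborel)"
  for \<Omega> :: "(real ^ 'n) set"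
  by (simp add: frac_perimeter_def nn_integral_completion)

text \<open>It permits the exchange of a Lebesgue set for a Borel subset of full measure in it,
  without changing the energy.\<close>

lemma frac_perimeter_cong_null:
  fixes \<Omega> :: "(real ^ 'n) set"
  assumes "N \<in> null_sets lborel" "U - N = V - N"
  shows "frac_perimeter \<delta> \<tau> U \<Omega> = frac_perimeter \<delta> \<tau> V \<Omega>"
proof -
  have AE: "AE x in lborel. x \<notin> N" by (rule AE_not_in[OF assms(1)])
  have ind: "indicator U x = (indicator V x :: real)" if "x \<notin> N" for x
    using assms(2) that by (auto simp: indicator_def)
  show ?thesis
    unfolding frac_perimeter_lborel
  proof (rule nn_integral_cong_AE, use AE in eventually_elim)
    case (elim y)
    show ?case
      by (rule arg_cong2[where f="(*)"], rule nn_integral_cong_AE, use AE in eventually_elim)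
        (simp_all add: ind elim)
  qed
qed

text \<open>For two points of \<Omega> passing to the complement only changes the sign of the
  difference of indicators. Hence a cover of \<Omega> - U may be paid for by the energy of
  U.\<close>

lemma frac_perimeter_complement:
  fixes \<Omega> :: "(real ^ 'n) set"
  shows "frac_perimeter \<delta> \<tau> (\<Omega> - U) \<Omega> = frac_perimeter \<delta> \<tau> U \<Omega>"
  unfolding frac_perimeter_lborel
proof (rule nn_integral_cong)
  fix y :: "real ^ 'n"
  have "(\<integral>\<^sup>+x\<in>{x \<in> \<Omega>. norm (x - y) < \<tau> * bdry_dist \<Omega> y}.
        ennreal (\<bar>indicator (\<Omega> - U) x - indicator (\<Omega> - U) y\<bar> / norm (x - y) powr (real CARD('n) + \<delta>)) \<partial>lborel)
    = (\<integral>\<^sup>+x\<in>{x \<in> \<Omega>. norm (x - y) < \<tau> * bdry_dist \<Omega> y}.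
        ennreal (\<bar>indicator U x - indicator U y\<bar> / norm (x - y) powr (real CARD('n) + \<delta>)) \<partial>lborel)" if "y \<in> \<Omega>"
    using that by (intro nn_integral_cong) (auto simp: indicator_def)
  then show "(\<integral>\<^sup>+x\<in>{x \<in> \<Omega>. norm (x - y) < \<tau> * bdry_dist \<Omega> y}.
        ennreal (\<bar>indicator (\<Omega> - U) x - indicator (\<Omega> - U) y\<bar> / norm (x - y) powr (real CARD('n) + \<delta>)) \<partial>lborel) * indicator \<Omega> y
    = (\<integral>\<^sup>+x\<in>{x \<in> \<Omega>. norm (x - y) < \<tau> * bdry_dist \<Omega> y}.
        ennreal (\<bar>indicator U x - indicator U y\<bar> / norm (x - y) powr (real CARD('n) + \<delta>)) \<partial>lborel) * indicator \<Omega> y"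
    by (cases "y \<in> \<Omega>") simp_all
qed

section \<open>Distance to the boundary of a bounded domain\<close>

lemma frontier_nonempty_bounded:
  fixes \<Omega> :: "(real ^ 'n) set"
  assumes "bounded \<Omega>" "\<Omega> \<noteq> {}"
  shows "frontier \<Omega> \<noteq> {}"
  using assms frontier_eq_empty not_bounded_UNIV by metis

lemma bdry_dist_nonneg: "0 \<le> bdry_dist \<Omega> x"
  by (simp add: bdry_dist_def infdist_nonneg)

lemma bdry_dist_pos:
  fixes \<Omega> :: "(real ^ 'n) set"
  assumes "bounded \<Omega>" "open \<Omega>" "x \<in> \<Omega>"
  shows "bdry_dist \<Omega> x > 0"
  unfolding bdry_dist_def
  using assms frontier_nonempty_bounded[of \<Omega>]
  by (intro infdist_pos_not_in_closed) (auto simp: frontier_def interior_open)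

lemma bdry_dist_triangle: "bdry_dist \<Omega> x \<le> bdry_dist \<Omega> y + dist x y"
  unfolding bdry_dist_def by (rule infdist_triangle)

lemma continuous_on_bdry_dist: "continuous_on A g \<Longrightarrow> continuous_on A (\<lambda>t. bdry_dist \<Omega> (g t))"
  unfolding bdry_dist_def by (intro continuous_intros)

text \<open>A connected ball that meets \<Omega> without being contained in it meets the frontier,
  at a distance from x smaller than the infimum of such distances.\<close>

lemma ball_bdry_dist_subset:
  fixes \<Omega> :: "(real ^ 'n) set"
  assumes "x \<in> \<Omega>"
  shows "ball x (bdry_dist \<Omega> x) \<subseteq> \<Omega>"
proof (rule ccontr)
  assume not: "\<not> ball x (bdry_dist \<Omega> x) \<subseteq> \<Omega>"
  then have "bdry_dist \<Omega> x > 0" by (cases "bdry_dist \<Omega> x \<le> 0") (auto simp: ball_empty)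
  then have "ball x (bdry_dist \<Omega> x) \<inter> \<Omega> \<noteq> {}" using assms centre_in_ball by blast
  then have "ball x (bdry_dist \<Omega> x) \<inter> frontier \<Omega> \<noteq> {}"
    using not by (intro connected_Int_frontier) auto
  then obtain p where p: "p \<in> frontier \<Omega>" "dist x p < bdry_dist \<Omega> x" by auto
  then show False using infdist_le[OF p(1), of x] by (simp add: bdry_dist_def)
qed

lemma bdry_dist_bounded:
  fixes \<Omega> :: "(real ^ 'n) set"
  assumes "bounded \<Omega>" "\<Omega> \<noteq> {}"
  obtains M where "M > 0" "\<forall>x\<in>\<Omega>. bdry_dist \<Omega> x \<le> M" "\<forall>x\<in>\<Omega>. \<forall>y\<in>\<Omega>. dist x y \<le> M"
proof -
  obtain b where b: "b > 0" "\<And>x. x \<in> closure \<Omega> \<Longrightarrow> norm x \<le> b"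
    using bounded_closure[OF assms(1)] bounded_pos by metis
  have d: "dist x y \<le> 2 * b" if "x \<in> closure \<Omega>" "y \<in> closure \<Omega>" for x y
    using norm_triangle_ineq4[of x y] b(2)[OF that(1)] b(2)[OF that(2)] by (simp add: dist_norm)
  obtain p where p: "p \<in> frontier \<Omega>" using frontier_nonempty_bounded[OF assms] by auto
  have "bdry_dist \<Omega> x \<le> 2 * b" if "x \<in> \<Omega>" for x
    unfolding bdry_dist_def
    using d[of x p] p that closure_subset[of \<Omega>] by (intro infdist_le2[OF p]) (auto simp: frontier_def)
  then show thesis using that[of "2 * b"] b d closure_subset[of \<Omega>] by (simp add: subset_iff)
qed

text \<open>Origin of \<tau>/4: if r \<le> \<tau>/4 d(z), then r \<le> d(z)/4, so every y in the
  ball has d(y) > d(z)/2 and \<tau> d(y) > 2r, which exceeds the distance from y to any other point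
  of the ball. All pairs inside one ball thus survive the truncation, and disjointness prevents
  double counting.\<close>

lemma sum_ball_energy_le_frac_perimeter:
  fixes \<Omega> :: "(real ^ 'n) set" and z :: "'i \<Rightarrow> real ^ 'n"
  assumes [measurable]: "U \<in> sets borel" and "finite F" and \<tau>: "0 < \<tau>" "\<tau> < 1"
    and F: "\<And>i. i \<in> F \<Longrightarrow> z i \<in> \<Omega> \<and> 0 < r i \<and> r i \<le> \<tau> / 4 * bdry_dist \<Omega> (z i)"
    and disj: "\<And>i j. i \<in> F \<Longrightarrow> j \<in> F \<Longrightarrow> i \<noteq> j \<Longrightarrow> ball (z i) (r i) \<inter> ball (z j) (r j) = {}"
  shows "(\<Sum>i\<in>F. \<integral>\<^sup>+y\<in>ball (z i) (r i). (\<integral>\<^sup>+x\<in>ball (z i) (r i).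
      ennreal (\<bar>indicator U x - indicator U y\<bar> / norm (x - y) powr (real CARD('n) + \<delta>)) \<partial>lborel) \<partial>lborel)
    \<le> frac_perimeter \<delta> \<tau> U \<Omega>"
proof -
  let ?k = "\<lambda>x y. ennreal (\<bar>indicator U x - indicator U y\<bar> / norm (x - y) powr (real CARD('n) + \<delta>))"
  let ?B = "\<lambda>i. ball (z i) (r i)"
  let ?T = "\<lambda>y. {x \<in> \<Omega>. norm (x - y) < \<tau> * bdry_dist \<Omega> y}"
  have [measurable]: "?B i \<in> sets borel" for i by simp
  have in_T: "y \<in> \<Omega> \<and> ?B i \<subseteq> ?T y" if i: "i \<in> F" and y: "y \<in> ?B i" for i y
  proof -
    let ?d = "bdry_dist \<Omega> (z i)"
    have r: "r i \<le> \<tau> / 4 * ?d" "0 < r i" "z i \<in> \<Omega>" using F[OF i] by auto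
    have "\<tau> / 4 * ?d \<le> 1 / 4 * ?d" using \<tau> bdry_dist_nonneg by (intro mult_right_mono) auto
    then have rd: "r i \<le> ?d / 4" using r by linarith
    then have "?B i \<subseteq> ball (z i) ?d" using r by (intro subset_ball) auto
    then have sub: "?B i \<subseteq> \<Omega>" using ball_bdry_dist_subset[OF r(3)] by blast
    have "?d \<le> bdry_dist \<Omega> y + r i" using bdry_dist_triangle[of \<Omega> "z i" y] y by auto
    then have "?d / 2 < bdry_dist \<Omega> y" using rd r by linarith
    then have "\<tau> * (?d / 2) < \<tau> * bdry_dist \<Omega> y" using \<tau> by (intro mult_strict_left_mono) auto
    then have "2 * r i < \<tau> * bdry_dist \<Omega> y" using r by (simp add: field_simps)
    moreover have "norm (x - y) < 2 * r i" if "x \<in> ?B i" for x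
      using that y dist_triangle2[of x y "z i"] by (simp add: dist_norm[symmetric] dist_commute)
    ultimately show ?thesis using sub y by force
  qed
  have "(\<Sum>i\<in>F. \<integral>\<^sup>+y\<in>?B i. (\<integral>\<^sup>+x\<in>?B i. ?k x y \<partial>lborel) \<partial>lborel)
      = (\<integral>\<^sup>+y. (\<Sum>i\<in>F. (\<integral>\<^sup>+x\<in>?B i. ?k x y \<partial>lborel) * indicator (?B i) y) \<partial>lborel)"
    by (rule nn_integral_sum[symmetric]) measurable
  also have "\<dots> \<le> frac_perimeter \<delta> \<tau> U \<Omega>"
    unfolding frac_perimeter_lborel
  proof (rule nn_integral_mono)
    fix y :: "real ^ 'n"
    show "(\<Sum>i\<in>F. (\<integral>\<^sup>+x\<in>?B i. ?k x y \<partial>lborel) * indicator (?B i) y)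
        \<le> (\<integral>\<^sup>+x\<in>?T y. ?k x y \<partial>lborel) * indicator \<Omega> y"
    proof (cases "\<exists>j\<in>F. y \<in> ?B j")
      case True
      then obtain j where j: "j \<in> F" "y \<in> ?B j" by blast
      \<comment> \<open>At most one ball of the disjoint family contains y, so the sum has a single
        nonzero term.\<close>
      have "(\<Sum>i\<in>F. (\<integral>\<^sup>+x\<in>?B i. ?k x y \<partial>lborel) * indicator (?B i) y)
          = (\<Sum>i\<in>{j}. (\<integral>\<^sup>+x\<in>?B i. ?k x y \<partial>lborel) * indicator (?B i) y)"
      proof (rule sum.mono_neutral_right[OF \<open>finite F\<close>])
        have "y \<notin> ?B i" if "i \<in> F - {j}" for i using that j disj[of i j] by blast
        then show "\<forall>i\<in>F - {j}. (\<integral>\<^sup>+x\<in>?B i. ?k x y \<partial>lborel) * indicator (?B i) y = 0" by simp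
      qed (use j in simp)
      also have "\<dots> = (\<integral>\<^sup>+x\<in>?B j. ?k x y \<partial>lborel)" using j by simp
      also have "\<dots> \<le> (\<integral>\<^sup>+x\<in>?T y. ?k x y \<partial>lborel)"
        using in_T[OF j] by (intro nn_integral_mono) (auto simp: indicator_def)
      finally show ?thesis using in_T[OF j] by simp
    next
      case False
      then have "(\<Sum>i\<in>F. (\<integral>\<^sup>+x\<in>?B i. ?k x y \<partial>lborel) * indicator (?B i) y) = 0"
        by (intro sum.neutral) auto
      then show ?thesis by simp
    qed
  qed
  finally show ?thesis .
qed

text \<open>This is literally the inner clause of \<open>boxing_inequality\<close> with its
  right-hand side replaced by K, so the symmetric equation folds one into the other.\<close>

definition boxing_cover :: "real \<Rightarrow> (real ^ 'n) set \<Rightarrow> ennreal \<Rightarrow> bool" where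
  "boxing_cover \<delta> U K \<longleftrightarrow>
     (\<exists>N \<in> null_sets lebesgue. (open U \<longrightarrow> N = {}) \<and>
        (\<exists>(I :: nat set) (c :: nat \<Rightarrow> real ^ 'n) (r :: nat \<Rightarrow> real).
           (\<forall>i\<in>I. r i > 0) \<and> U - N \<subseteq> (\<Union>i\<in>I. ball (c i) (r i)) \<and>
           (\<Sum>\<^sub>\<infinity>i\<in>I. ennreal (r i powr (real CARD('n) - \<delta>))) \<le> K))"

text \<open>An \<open>infsum\<close> of nonnegative terms is the supremum of its finite partial
  sums, so bounds for finite subfamilies are enough. Vitali families are indexed by pairs of centre
  and radius; \<open>to_nat_on\<close> transports them to the naturals.\<close>

lemma boxing_coverI_countable:
  fixes U :: "(real ^ 'n) set" and c :: "'i \<Rightarrow> real ^ 'n"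
  assumes N: "N \<in> null_sets lebesgue" "open U \<Longrightarrow> N = {}" and C: "countable C" "\<And>i. i \<in> C \<Longrightarrow> r i > 0"
    and cover: "U - N \<subseteq> (\<Union>i\<in>C. ball (c i) (r i))"
    and le: "\<And>F. finite F \<Longrightarrow> F \<subseteq> C \<Longrightarrow> (\<Sum>i\<in>F. ennreal (r i powr (real CARD('n) - \<delta>))) \<le> K"
  shows "boxing_cover \<delta> U K"
proof -
  define f where "f = from_nat_into C"
  define I where "I = to_nat_on C ` C"
  have fI: "f (to_nat_on C i) = i" if "i \<in> C" for i
    using C(1) that by (simp add: f_def)
  have f_in: "f i \<in> C" if "i \<in> I" for i using that fI by (auto simp: I_def)
  have inj: "inj_on f I" by (auto simp: inj_on_def I_def fI)
  have "(\<Sum>\<^sub>\<infinity>i\<in>I. ennreal (r (f i) powr (real CARD('n) - \<delta>))) \<le> K"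
  proof (subst nonneg_infsum_complete, simp, rule SUP_least)
    fix F assume "F \<in> {F. finite F \<and> F \<subseteq> I}"
    then have F: "finite F" "F \<subseteq> I" by auto
    have "(\<Sum>i\<in>F. ennreal (r (f i) powr (real CARD('n) - \<delta>))) = (\<Sum>i\<in>f ` F. ennreal (r i powr (real CARD('n) - \<delta>)))"
      using inj_on_subset[OF inj F(2)] by (simp add: sum.reindex)
    also have "\<dots> \<le> K" using F f_in by (intro le) auto
    finally show "(\<Sum>i\<in>F. ennreal (r (f i) powr (real CARD('n) - \<delta>))) \<le> K" .
  qed
  moreover have "U - N \<subseteq> (\<Union>i\<in>I. ball (c (f i)) (r (f i)))"
    using cover by (auto simp: I_def fI)
  ultimately show ?thesis
    unfolding boxing_cover_def using N C(2) f_in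
    by (intro bexI[of _ N] conjI impI exI[of _ I] exI[of _ "\<lambda>i. c (f i)"] exI[of _ "\<lambda>i. r (f i)"]) auto
qed

lemma boxing_cover_mono: "boxing_cover \<delta> U K \<Longrightarrow> K \<le> L \<Longrightarrow> boxing_cover \<delta> U L"
  unfolding boxing_cover_def by (meson order_trans)

text \<open>Let the powers r powr (n - \<delta>) have sum at most k. Then each single one is at most
  k, hence r powr n \<le> r powr (n - \<delta>) * k powr (\<delta> / (n - \<delta>)), and summation
  bounds the volume by \<omega> k powr (n / (n - \<delta>)). The maximum with 1 bounds \<omega> powr
  ((n - \<delta>) / n) for all \<delta> at once.\<close>

lemma measure_powr_le_boxing_cover:
  fixes U :: "(real ^ 'n) set"
  assumes \<delta>: "0 < \<delta>" "\<delta> < 1" and U: "U \<in> lmeasurable" and cover: "boxing_cover \<delta> U K"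
  shows "ennreal (measure lebesgue U powr ((real CARD('n) - \<delta>) / real CARD('n)))
    \<le> ennreal (max 1 (unit_ball_vol (real CARD('n)))) * K"
proof (cases K)
  case top
  then show ?thesis by (simp add: ennreal_mult_top less_max_iff_disj)
next
  case (real k)
  define n where "n = real CARD('n)"
  have n: "n \<ge> 1" unfolding n_def using zero_less_card_finite[where 'a='n] by linarith
  define \<omega> where "\<omega> = unit_ball_vol n"
  have \<omega>: "\<omega> > 0" using n by (simp add: \<omega>_def)
  obtain N I c r where N: "N \<in> null_sets lebesgue" and r: "\<And>i::nat. i \<in> I \<Longrightarrow> r i > 0"
    and sub: "U - N \<subseteq> (\<Union>i\<in>I. ball (c i) (r i))"
    and sum: "(\<Sum>\<^sub>\<infinity>i\<in>I. ennreal (r i powr (n - \<delta>))) \<le> K"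
    using cover unfolding boxing_cover_def n_def by blast
  have fin: "(\<Sum>i\<in>F. r i powr (n - \<delta>)) \<le> k" if F: "finite F" "F \<subseteq> I" for F
  proof -
    have "ennreal (\<Sum>i\<in>F. r i powr (n - \<delta>)) = (\<Sum>i\<in>F. ennreal (r i powr (n - \<delta>)))"
      by (simp add: sum_ennreal)
    also have "\<dots> \<le> (\<Sum>\<^sub>\<infinity>i\<in>I. ennreal (r i powr (n - \<delta>)))"
      using F by (subst nonneg_infsum_complete, simp) (auto intro!: SUP_upper)
    also have "\<dots> \<le> ennreal k" using sum real by simp
    finally show ?thesis using real by simp
  qed
  have volume: "r i powr n \<le> r i powr (n - \<delta>) * k powr (\<delta> / (n - \<delta>))" if "i \<in> I" for i
  proof -
    have "r i powr \<delta> = (r i powr (n - \<delta>)) powr (\<delta> / (n - \<delta>))"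
      using n \<delta> by (simp add: powr_powr)
    also have "\<dots> \<le> k powr (\<delta> / (n - \<delta>))"
      using fin[of "{i}"] that n \<delta> by (intro powr_mono2) auto
    finally have "r i powr (n - \<delta>) * r i powr \<delta> \<le> r i powr (n - \<delta>) * k powr (\<delta> / (n - \<delta>))"
      by (intro mult_left_mono) auto
    then show ?thesis by (simp add: powr_add[symmetric])
  qed
  define B where "B i = (if i \<in> I then ball (c i) (r i) else {})" for i
  have B: "emeasure lebesgue (B i) = ennreal (if i \<in> I then \<omega> * r i powr n else 0)" for i
    using emeasure_ball[of "r i" "c i"] r[of i] by (cases "i \<in> I") (simp_all add: B_def \<omega>_def n_def powr_realpow)
  have "emeasure lebesgue U \<le> emeasure lebesgue (N \<union> (\<Union>i. B i))"
    using sub N by (intro emeasure_mono) (auto simp: B_def null_sets_def intro!: sets.Un split: if_splits)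
  also have "\<dots> = emeasure lebesgue (\<Union>i. B i)"
    using N by (subst Un_commute, intro emeasure_Un_null_set) (auto simp: B_def)
  also have "\<dots> \<le> (\<Sum>i. emeasure lebesgue (B i))"
    by (intro emeasure_subadditive_countably) (auto simp: B_def)
  also have "\<dots> \<le> ennreal (\<omega> * (k * k powr (\<delta> / (n - \<delta>))))"
  proof (rule suminf_le_const)
    fix m
    have "(\<Sum>i<m. emeasure lebesgue (B i)) = ennreal (\<Sum>i<m. if i \<in> I then \<omega> * r i powr n else 0)"
      using \<omega> by (simp add: B)
    also have "(\<Sum>i<m. if i \<in> I then \<omega> * r i powr n else 0) = (\<Sum>i\<in>{..<m} \<inter> I. \<omega> * r i powr n)"
      by (simp add: sum.inter_restrict)
    also have "\<dots> \<le> (\<Sum>i\<in>{..<m} \<inter> I. \<omega> * (r i powr (n - \<delta>) * k powr (\<delta> / (n - \<delta>))))"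
      using \<omega> by (intro sum_mono mult_left_mono volume) auto
    also have "\<dots> = \<omega> * ((\<Sum>i\<in>{..<m} \<inter> I. r i powr (n - \<delta>)) * k powr (\<delta> / (n - \<delta>)))"
      by (simp add: sum_distrib_left sum_distrib_right)
    also have "\<dots> \<le> \<omega> * (k * k powr (\<delta> / (n - \<delta>)))"
      using \<omega> by (intro mult_left_mono mult_right_mono fin) auto
    finally show "(\<Sum>i<m. emeasure lebesgue (B i)) \<le> ennreal (\<omega> * (k * k powr (\<delta> / (n - \<delta>))))"
      by (simp add: ennreal_leI)
  qed simp
  finally have le: "measure lebesgue U \<le> \<omega> * (k * k powr (\<delta> / (n - \<delta>)))"
    unfolding emeasure_eq_measure2[OF U] using \<omega> real by (subst (asm) ennreal_le_iff) auto
  have "measure lebesgue U powr ((n - \<delta>) / n) \<le> (\<omega> * (k * k powr (\<delta> / (n - \<delta>)))) powr ((n - \<delta>) / n)"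
    using le n \<delta> by (intro powr_mono2) auto
  also have "\<dots> = \<omega> powr ((n - \<delta>) / n) * (k powr ((n - \<delta>) / n) * k powr (\<delta> / n))"
    using \<omega> real n \<delta> by (simp add: powr_mult powr_powr)
  also have "k powr ((n - \<delta>) / n) * k powr (\<delta> / n) = k"
    using n real by (simp add: powr_add[symmetric] diff_divide_distrib)
  also have "\<omega> powr ((n - \<delta>) / n) * k \<le> max 1 \<omega> * k"
  proof (rule mult_right_mono)
    have "\<omega> powr ((n - \<delta>) / n) \<le> max 1 \<omega> powr ((n - \<delta>) / n)"
      using \<omega> n \<delta> by (intro powr_mono2) auto
    also have "\<dots> \<le> max 1 \<omega> powr 1" using n \<delta> by (intro powr_mono) auto
    finally show "\<omega> powr ((n - \<delta>) / n) \<le> max 1 \<omega>" by simp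
  qed (use real in auto)
  finally show ?thesis using real by (simp add: n_def \<omega>_def ennreal_mult[symmetric] ennreal_leI)
qed

text \<open>The minimum lies below both volumes, so a cover of whichever of U and \<Omega> - U is
  convenient suffices.\<close>

lemma isoperimetric_ineqI:
  fixes \<Omega> :: "(real ^ 'n) set"
  assumes \<delta>: "0 < \<delta>" "\<delta> < 1" and \<Omega>: "\<Omega> \<in> lmeasurable" and C: "C > 0"
    and cover: "\<And>U. U \<in> sets lebesgue \<Longrightarrow> U \<subseteq> \<Omega> \<Longrightarrow>
      boxing_cover \<delta> U (ennreal (C * (1 - \<delta>)) * frac_perimeter \<delta> \<tau> U \<Omega>) \<or>
      boxing_cover \<delta> (\<Omega> - U) (ennreal (C * (1 - \<delta>)) * frac_perimeter \<delta> \<tau> U \<Omega>)"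
  shows "isoperimetric_ineq (max 1 (unit_ball_vol (real CARD('n))) * C) \<delta> \<tau> \<Omega>"
  unfolding isoperimetric_ineq_def
proof (intro ballI impI)
  fix U assume U: "U \<in> sets lebesgue" "U \<subseteq> \<Omega>"
  let ?p = "(real CARD('n) - \<delta>) / real CARD('n)"
  define W where "W = max 1 (unit_ball_vol (real CARD('n)))"
  have "W \<ge> 1" by (simp add: W_def)
  have "real CARD('n) \<ge> 1" using zero_less_card_finite[where 'a='n] by linarith
  then have "real CARD('n) - \<delta> \<ge> 0" using \<delta> by linarith
  then have p: "?p \<ge> 0" by (rule divide_nonneg_nonneg) simp
  have "ennreal (min (measure lebesgue U) (measure lebesgue (\<Omega> - U)) powr ?p)
      \<le> ennreal W * (ennreal (C * (1 - \<delta>)) * frac_perimeter \<delta> \<tau> U \<Omega>)"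
    using cover[OF U]
  proof
    assume *: "boxing_cover \<delta> U (ennreal (C * (1 - \<delta>)) * frac_perimeter \<delta> \<tau> U \<Omega>)"
    have "ennreal (min (measure lebesgue U) (measure lebesgue (\<Omega> - U)) powr ?p) \<le> ennreal (measure lebesgue U powr ?p)"
      using p by (intro ennreal_leI powr_mono2) auto
    also have "\<dots> \<le> ennreal W * (ennreal (C * (1 - \<delta>)) * frac_perimeter \<delta> \<tau> U \<Omega>)"
      unfolding W_def by (rule measure_powr_le_boxing_cover[OF \<delta> fmeasurableI2[OF \<Omega> U(2,1)] *])
    finally show ?thesis .
  next
    assume *: "boxing_cover \<delta> (\<Omega> - U) (ennreal (C * (1 - \<delta>)) * frac_perimeter \<delta> \<tau> U \<Omega>)"
    have "ennreal (min (measure lebesgue U) (measure lebesgue (\<Omega> - U)) powr ?p) \<le> ennreal (measure lebesgue (\<Omega> - U) powr ?p)"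
      using p by (intro ennreal_leI powr_mono2) auto
    also have "\<dots> \<le> ennreal W * (ennreal (C * (1 - \<delta>)) * frac_perimeter \<delta> \<tau> U \<Omega>)"
      unfolding W_def by (rule measure_powr_le_boxing_cover[OF \<delta> fmeasurable_Diff[OF \<Omega> U(1)] *])
    finally show ?thesis .
  qed
  also have "\<dots> = ennreal (W * C * (1 - \<delta>)) * frac_perimeter \<delta> \<tau> U \<Omega>"
    using \<delta> C \<open>W \<ge> 1\<close> by (simp only: mult.assoc[symmetric], subst ennreal_mult[symmetric]) (auto simp: mult.assoc)
  finally show "ennreal (min (measure lebesgue U) (measure lebesgue (\<Omega> - U)) powr ?p)
      \<le> ennreal (max 1 (unit_ball_vol (real CARD('n))) * C * (1 - \<delta>)) * frac_perimeter \<delta> \<tau> U \<Omega>"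
    by (simp only: W_def)
qed

subsection \<open>John domains\<close>

text \<open>If the ball of radius \<epsilon> d(x) about x has density at most one half, the centre
  stays fixed and the radius runs from s to \<epsilon> d(x). Otherwise that ball is the starting
  point and the ball moves along g with radius \<epsilon> d(g t) until the one about xJ. The John
  inequality bounds the distance of the final centre from x by CJ/\<epsilon> times the final
  radius.\<close>

lemma half_density_ball_John:
  fixes \<Omega> U :: "(real ^ 'n) set"
  assumes U: "U \<in> sets borel" and \<Omega>: "bounded \<Omega>" "open \<Omega>" and \<epsilon>: "\<epsilon> > 0" and CJ: "CJ \<ge> 1"
    and x: "x \<in> \<Omega>" and g: "curve_in \<Omega> x xJ g"
    and John: "\<And>t. t \<in> {0..1} \<Longrightarrow> CJ * bdry_dist \<Omega> (g t) > norm (g t - x)"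
    and centre: "measure lborel (U \<inter> ball xJ (\<epsilon> * bdry_dist \<Omega> xJ)) \<le> measure lborel (ball xJ (\<epsilon> * bdry_dist \<Omega> xJ)) / 2"
    and s: "0 < s" "s \<le> \<epsilon> * bdry_dist \<Omega> x" "measure lborel (U \<inter> ball x s) \<ge> measure lborel (ball x s) / 2"
  shows "\<exists>z r. z \<in> \<Omega> \<and> 0 < r \<and> r \<le> \<epsilon> * bdry_dist \<Omega> z \<and> dist z x \<le> CJ / \<epsilon> * r
    \<and> measure lborel (U \<inter> ball z r) = measure lborel (ball z r) / 2"
proof (cases "measure lborel (U \<inter> ball x (\<epsilon> * bdry_dist \<Omega> x)) \<le> measure lborel (ball x (\<epsilon> * bdry_dist \<Omega> x)) / 2")
  case True
  then have "\<exists>t\<in>{s..\<epsilon> * bdry_dist \<Omega> x}. measure lborel (U \<inter> ball x t) = measure lborel (ball x t) / 2"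
    using s by (intro half_density_on_path[OF U, where z="\<lambda>_. x" and r="\<lambda>t. t"]) (auto intro: continuous_intros)
  then obtain t where t: "s \<le> t" "t \<le> \<epsilon> * bdry_dist \<Omega> x" "measure lborel (U \<inter> ball x t) = measure lborel (ball x t) / 2"
    by auto
  moreover have "0 \<le> CJ / \<epsilon> * t" using t(1) s \<epsilon> CJ by simp
  ultimately show ?thesis using s x by (intro exI[of _ x] exI[of _ t]) auto
next
  case False
  have g': "continuous_on {0..1} g" "g 0 = x" "g 1 = xJ" "\<And>t. t \<in> {0..1} \<Longrightarrow> g t \<in> \<Omega>"
    using g by (auto simp: curve_in_def path_def pathstart_def pathfinish_def path_image_def)
  have "\<exists>t\<in>{0..1}. measure lborel (U \<inter> ball (g t) (\<epsilon> * bdry_dist \<Omega> (g t)))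
      = measure lborel (ball (g t) (\<epsilon> * bdry_dist \<Omega> (g t))) / 2"
    using False centre \<epsilon> g'(1-3) bdry_dist_nonneg[of \<Omega>]
    by (intro half_density_on_path[OF U]) (auto intro!: continuous_intros continuous_on_bdry_dist)
  then obtain t where t: "t \<in> {0..1}" "measure lborel (U \<inter> ball (g t) (\<epsilon> * bdry_dist \<Omega> (g t)))
      = measure lborel (ball (g t) (\<epsilon> * bdry_dist \<Omega> (g t))) / 2" by blast
  have "0 < \<epsilon> * bdry_dist \<Omega> (g t)"
    using bdry_dist_pos[OF \<Omega> g'(4)[OF t(1)]] \<epsilon> by simp
  moreover have "dist (g t) x \<le> CJ / \<epsilon> * (\<epsilon> * bdry_dist \<Omega> (g t))"
    using John[OF t(1)] \<epsilon> by (simp add: dist_norm)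
  ultimately show ?thesis using t(2) g'(4)[OF t(1)] by blast
qed

text \<open>Enlarged by CJ/\<epsilon> + 1, with \<epsilon> = \<tau>/4, a half-density ball found
  from x contains x; Vitali's lemma costs a further factor 5. It is applied to the enlarged balls,
  so the original ones are disjoint and their energies add up. The n-th power of the enlargement
  bounds its power n - \<delta>, which keeps the first factor free of \<delta>.\<close>

lemma John_boxing_cover_borel:
  fixes \<Omega> :: "(real ^ 'n) set"
  assumes \<tau>: "0 < \<tau>" "\<tau> < 1" and \<Omega>: "bounded \<Omega>" "open \<Omega>" and CJ: "CJ \<ge> 1" and xJ: "xJ \<in> \<Omega>"
    and John: "\<And>x. x \<in> \<Omega> \<Longrightarrow> \<exists>g. curve_in \<Omega> x xJ g \<and> (\<forall>t\<in>{0..1}. CJ * bdry_dist \<Omega> (g t) > norm (g t - x))"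
    and \<delta>: "0 < \<delta>" "\<delta> < 1"
    and U: "U \<in> sets borel" "U \<subseteq> \<Omega>"
    and centre: "measure lborel (U \<inter> ball xJ (\<tau> / 4 * bdry_dist \<Omega> xJ)) \<le> measure lborel (ball xJ (\<tau> / 4 * bdry_dist \<Omega> xJ)) / 2"
  shows "boxing_cover \<delta> U (ennreal ((5 * (CJ / (\<tau> / 4) + 1)) ^ CARD('n) *
    (16 * 2 ^ (CARD('n) + 1) / (unit_ball_vol (real CARD('n)))\<^sup>2) * (1 - \<delta>)) * frac_perimeter \<delta> \<tau> U \<Omega>)"
proof -
  define \<epsilon> where "\<epsilon> = \<tau> / 4"
  define L where "L = CJ / \<epsilon> + 1"
  define Cn :: real where "Cn = 16 * 2 ^ (CARD('n) + 1) / (unit_ball_vol (real CARD('n)))\<^sup>2"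
  have \<epsilon>: "\<epsilon> > 0" and L: "L \<ge> 1" and Cn: "Cn \<ge> 0" using \<tau> CJ by (auto simp: \<epsilon>_def L_def Cn_def)
  define K where "K = {(z, r). z \<in> \<Omega> \<and> 0 < r \<and> r \<le> \<epsilon> * bdry_dist \<Omega> z
    \<and> measure lborel (U \<inter> ball z r) = measure lborel (ball z r) / 2}"
  have bU: "bounded U" using \<Omega> U bounded_subset by blast
  obtain N where N: "N \<in> null_sets lborel" "open U \<Longrightarrow> N = {}" and dens:
    "\<And>x. x \<in> U - N \<Longrightarrow> \<exists>s\<in>{0<..\<epsilon> * bdry_dist \<Omega> x}. measure lborel (U \<inter> ball x s) \<ge> measure lborel (ball x s) / 2"
  proof (cases "open U")
    case True
    \<comment> \<open>Around a point of an open set small balls have density one, so no exceptional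
      set arises.\<close>
    have "\<exists>s\<in>{0<..\<epsilon> * bdry_dist \<Omega> x}. measure lborel (U \<inter> ball x s) \<ge> measure lborel (ball x s) / 2" if x: "x \<in> U" for x
    proof -
      obtain e where e: "e > 0" "ball x e \<subseteq> U" using True x open_contains_ball by blast
      define s where "s = min e (\<epsilon> * bdry_dist \<Omega> x)"
      have "s > 0" using e \<epsilon> bdry_dist_pos[OF \<Omega>, of x] x U by (auto simp: s_def)
      moreover have "U \<inter> ball x s = ball x s" using e by (auto simp: s_def)
      ultimately show ?thesis by (intro bexI[of _ s]) (auto simp: s_def)
    qed
    then show thesis using that[of "{}"] by auto
  next
    case False
    obtain N where "N \<in> null_sets lborel" "N \<subseteq> U"
      "\<forall>x\<in>U - N. \<exists>s\<in>{0<..\<epsilon> * bdry_dist \<Omega> x}. measure lborel (U \<inter> ball x s) \<ge> measure lborel (ball x s) / 2"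
    proof (rule half_density_AE[OF U(1) bU, of "\<lambda>x. \<epsilon> * bdry_dist \<Omega> x"])
      show "continuous_on UNIV (\<lambda>x. \<epsilon> * bdry_dist \<Omega> x)"
        by (intro continuous_intros continuous_on_bdry_dist)
      show "\<epsilon> * bdry_dist \<Omega> x > 0" if "x \<in> U" for x
        using \<epsilon> bdry_dist_pos[OF \<Omega>, of x] that U by auto
      show "0 \<le> \<epsilon> * bdry_dist \<Omega> x" for x using \<epsilon> bdry_dist_nonneg[of \<Omega> x] by simp
    qed (rule that, assumption+)
    then show thesis using that[of N] False by blast
  qed
  have cov: "U - N \<subseteq> (\<Union>i\<in>K. ball (fst i) (L * snd i))"
  proof
    fix x assume x: "x \<in> U - N"
    then have x\<Omega>: "x \<in> \<Omega>" using U by auto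
    obtain g where g: "curve_in \<Omega> x xJ g" "\<And>t. t \<in> {0..1} \<Longrightarrow> CJ * bdry_dist \<Omega> (g t) > norm (g t - x)"
      using John[OF x\<Omega>] by blast
    obtain s where s: "0 < s" "s \<le> \<epsilon> * bdry_dist \<Omega> x" "measure lborel (U \<inter> ball x s) \<ge> measure lborel (ball x s) / 2"
      using dens[OF x] by auto
    obtain z r where zr: "(z, r) \<in> K" "dist z x \<le> CJ / \<epsilon> * r"
      using half_density_ball_John[OF U(1) \<Omega> \<epsilon> CJ x\<Omega> g centre[folded \<epsilon>_def] s] by (auto simp: K_def)
    have "r > 0" using zr by (auto simp: K_def)
    then have "dist z x < L * r" using zr(2) by (simp add: L_def distrib_right)
    then show "x \<in> (\<Union>i\<in>K. ball (fst i) (L * snd i))" using zr(1) by force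
  qed
  have "\<Omega> \<noteq> {}" using xJ by auto
  then obtain M where M: "M > 0" "\<forall>x\<in>\<Omega>. bdry_dist \<Omega> x \<le> M" "\<forall>x\<in>\<Omega>. \<forall>y\<in>\<Omega>. dist x y \<le> M"
    by (rule bdry_dist_bounded[OF \<Omega>(1)])
  \<comment> \<open>Vitali's lemma requires a common bound for the radii; boundedness of \<Omega>
    supplies it.\<close>
  have rad: "0 < L * snd i \<and> L * snd i \<le> L * (\<epsilon> * M)" if "i \<in> K" for i
  proof -
    have "snd i \<le> \<epsilon> * bdry_dist \<Omega> (fst i)" "fst i \<in> \<Omega>" "0 < snd i" using that by (auto simp: K_def)
    moreover have "\<epsilon> * bdry_dist \<Omega> (fst i) \<le> \<epsilon> * M" using bspec[OF M(2) calculation(2)] \<epsilon> by simp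
    ultimately show ?thesis using L by auto
  qed
  obtain C where C: "countable C" "C \<subseteq> K"
    and disj: "pairwise (\<lambda>i j. disjnt (ball (fst i) (L * snd i)) (ball (fst j) (L * snd j))) C"
    and cov': "U - N \<subseteq> (\<Union>i\<in>C. ball (fst i) (5 * (L * snd i)))"
    by (rule Vitali_covering_lemma_balls[OF cov rad])
  show ?thesis
    unfolding \<epsilon>_def[symmetric] L_def[symmetric] Cn_def[symmetric]
  proof (rule boxing_coverI_countable[OF _ N(2) C(1) _ cov'])
    show "N \<in> null_sets lebesgue" using N(1) by (simp add: null_sets_completionI)
    show "0 < 5 * (L * snd i)" if "i \<in> C" for i using rad[of i] that C by auto
    fix F assume F: "finite F" "F \<subseteq> C"
    let ?E = "\<lambda>i. \<integral>\<^sup>+y\<in>ball (fst i) (snd i). (\<integral>\<^sup>+x\<in>ball (fst i) (snd i).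
      ennreal (\<bar>indicator U x - indicator U y\<bar> / norm (x - y) powr (real CARD('n) + \<delta>)) \<partial>lborel) \<partial>lborel"
    have FK: "fst i \<in> \<Omega>" "0 < snd i" "snd i \<le> \<tau> / 4 * bdry_dist \<Omega> (fst i)"
      "measure lborel (U \<inter> ball (fst i) (snd i)) = measure lborel (ball (fst i) (snd i)) / 2" if "i \<in> F" for i
      using F C that by (auto simp: K_def \<epsilon>_def)
    have one: "ennreal ((5 * (L * snd i)) powr (real CARD('n) - \<delta>)) \<le> ennreal ((5 * L) ^ CARD('n) * Cn * (1 - \<delta>)) * ?E i" if i: "i \<in> F" for i
    proof -
      have "(5 * L) powr (real CARD('n) - \<delta>) \<le> (5 * L) powr real CARD('n)"
        using L \<delta> by (intro powr_mono) auto
      also have "\<dots> = (5 * L) ^ CARD('n)" using L by (intro powr_realpow) auto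
      finally have "(5 * (L * snd i)) powr (real CARD('n) - \<delta>) \<le> (5 * L) ^ CARD('n) * snd i powr (real CARD('n) - \<delta>)"
        using L FK(2)[OF i] by (simp add: mult.assoc[symmetric] powr_mult mult_right_mono)
      then have "ennreal ((5 * (L * snd i)) powr (real CARD('n) - \<delta>)) \<le> ennreal ((5 * L) ^ CARD('n) * snd i powr (real CARD('n) - \<delta>))"
        by (rule ennreal_leI)
      also have "\<dots> = ennreal ((5 * L) ^ CARD('n)) * ennreal (snd i powr (real CARD('n) - \<delta>))"
        using L by (intro ennreal_mult) auto
      also have "\<dots> \<le> ennreal ((5 * L) ^ CARD('n)) * (ennreal (Cn * (1 - \<delta>)) * ?E i)"
        using relative_isoperimetric_ball[OF U(1) FK(2)[OF i] \<delta> FK(4)[OF i]]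
        by (intro mult_left_mono) (auto simp: Cn_def)
      also have "\<dots> = ennreal ((5 * L) ^ CARD('n) * Cn * (1 - \<delta>)) * ?E i"
        using L Cn \<delta> by (simp only: mult.assoc[symmetric], subst ennreal_mult[symmetric]) (auto simp: mult.assoc)
      finally show ?thesis .
    qed
    have "(\<Sum>i\<in>F. ennreal ((5 * (L * snd i)) powr (real CARD('n) - \<delta>)))
        \<le> (\<Sum>i\<in>F. ennreal ((5 * L) ^ CARD('n) * Cn * (1 - \<delta>)) * ?E i)"
      by (intro sum_mono one)
    also have "\<dots> = ennreal ((5 * L) ^ CARD('n) * Cn * (1 - \<delta>)) * (\<Sum>i\<in>F. ?E i)"
      by (simp only: sum_distrib_left)
    also have "\<dots> \<le> ennreal ((5 * L) ^ CARD('n) * Cn * (1 - \<delta>)) * frac_perimeter \<delta> \<tau> U \<Omega>"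
    proof (intro mult_left_mono sum_ball_energy_le_frac_perimeter[OF U(1) F(1) \<tau>])
      fix i j assume ij: "i \<in> F" "j \<in> F" "i \<noteq> j"
      have "snd k \<le> L * snd k" if "k \<in> F" for k using FK(2)[OF that] L by simp
      then have "ball (fst k) (snd k) \<subseteq> ball (fst k) (L * snd k)" if "k \<in> F" for k
        using that by (intro subset_ball) auto
      then show "ball (fst i) (snd i) \<inter> ball (fst j) (snd j) = {}"
        using ij F(2) disj unfolding pairwise_def disjnt_def by blast
    qed (use FK in auto)
    finally show "(\<Sum>i\<in>F. ennreal ((5 * (L * snd i)) powr (real CARD('n) - \<delta>)))
      \<le> ennreal ((5 * L) ^ CARD('n) * Cn * (1 - \<delta>)) * frac_perimeter \<delta> \<tau> U \<Omega>" .
  qed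
qed

text \<open>C and the test ball B are fixed before \<delta>, which is the origin of the uniformity
  in \<delta>. A Lebesgue set is replaced by a Borel subset that differs from it by a null set,
  except that an open set is kept, since there the exceptional set must be empty.\<close>

lemma John_boxing_cover:
  fixes \<Omega> :: "(real ^ 'n) set"
  assumes \<tau>: "0 < \<tau>" "\<tau> < 1" and John: "one_John_domain \<Omega>"
  obtains C B where "C > 0" "B \<in> lmeasurable" "B \<subseteq> \<Omega>"
    "\<forall>\<delta>\<in>{0<..<1}. \<forall>U\<in>sets lebesgue. U \<subseteq> \<Omega> \<longrightarrow> measure lebesgue (U \<inter> B) \<le> measure lebesgue B / 2
      \<longrightarrow> boxing_cover \<delta> U (ennreal (C * (1 - \<delta>)) * frac_perimeter \<delta> \<tau> U \<Omega>)"
proof -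
  have \<Omega>: "bounded \<Omega>" "open \<Omega>" using John by (auto simp: one_John_domain_def domain_def)
  obtain CJ xJ where CJ: "CJ \<ge> 1" and xJ: "xJ \<in> \<Omega>"
    and curve: "\<And>x. x \<in> \<Omega> \<Longrightarrow> \<exists>g. curve_in \<Omega> x xJ g \<and> (\<forall>t\<in>{0..1}. CJ * bdry_dist \<Omega> (g t) > norm (g t - x))"
    using John unfolding one_John_domain_def by blast
  define B where "B = ball xJ (\<tau> / 4 * bdry_dist \<Omega> xJ)"
  define C where "C = (5 * (CJ / (\<tau> / 4) + 1)) ^ CARD('n) * (16 * 2 ^ (CARD('n) + 1) / (unit_ball_vol (real CARD('n)))\<^sup>2)"
  have "0 < unit_ball_vol (real CARD('n))" by simp
  then have "C > 0" unfolding C_def using CJ \<tau> by (intro mult_pos_pos divide_pos_pos zero_less_power add_pos_pos) auto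
  moreover have "B \<in> lmeasurable" by (simp add: B_def)
  moreover have "B \<subseteq> \<Omega>"
  proof -
    have "\<tau> / 4 * bdry_dist \<Omega> xJ \<le> 1 * bdry_dist \<Omega> xJ"
      using \<tau> bdry_dist_nonneg[of \<Omega> xJ] by (intro mult_right_mono) auto
    then have "B \<subseteq> ball xJ (bdry_dist \<Omega> xJ)" unfolding B_def by (intro subset_ball) simp
    then show ?thesis using ball_bdry_dist_subset[OF xJ] by blast
  qed
  moreover have "boxing_cover \<delta> U (ennreal (C * (1 - \<delta>)) * frac_perimeter \<delta> \<tau> U \<Omega>)"
    if \<delta>: "\<delta> \<in> {0<..<1}" and U: "U \<in> sets lebesgue" "U \<subseteq> \<Omega>" "measure lebesgue (U \<inter> B) \<le> measure lebesgue B / 2" for \<delta> U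
  proof -
    obtain V N where V: "V \<in> sets borel" "V \<subseteq> U" "N \<in> null_sets lborel" "U - V \<subseteq> N" "open U \<Longrightarrow> V = U"
    proof (cases "open U")
      case True
      then show thesis using that[of U "{}"] by auto
    next
      case False
      obtain S N N' where "U = S \<union> N" "N \<subseteq> N'" "N' \<in> null_sets lborel" "S \<in> sets lborel"
        using sets_completionE[OF U(1)] by metis
      then show thesis using that[of S N'] False by auto
    qed
    have N': "N \<in> null_sets lebesgue" using V(3) by (simp add: null_sets_completionI)
    have "measure lborel (V \<inter> B) = measure lebesgue (V \<inter> B)" using V(1) by (simp add: B_def)
    also have "\<dots> \<le> measure lebesgue (U \<inter> B)"
      using V U(1) by (intro measure_mono_fmeasurable fmeasurableI2[OF lmeasurable_ball[of xJ "\<tau> / 4 * bdry_dist \<Omega> xJ"]])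
        (auto simp: B_def)
    also have "\<dots> \<le> measure lborel B / 2" using U(3) by (simp add: B_def)
    finally have cover: "boxing_cover \<delta> V (ennreal (C * (1 - \<delta>)) * frac_perimeter \<delta> \<tau> V \<Omega>)"
      using John_boxing_cover_borel[OF \<tau> \<Omega> CJ xJ curve _ _ V(1)] \<delta> V(2) U(2) by (auto simp: B_def C_def)
    moreover have "frac_perimeter \<delta> \<tau> V \<Omega> = frac_perimeter \<delta> \<tau> U \<Omega>"
      using V by (intro frac_perimeter_cong_null[OF V(3)]) auto
    ultimately obtain N1 I c r where *: "N1 \<in> null_sets lebesgue" "open V \<longrightarrow> N1 = {}" "\<forall>i\<in>I. r i > 0"
      "V - N1 \<subseteq> (\<Union>i\<in>I. ball (c i) (r i))"
      "(\<Sum>\<^sub>\<infinity>i\<in>(I::nat set). ennreal (r i powr (real CARD('n) - \<delta>))) \<le> ennreal (C * (1 - \<delta>)) * frac_perimeter \<delta> \<tau> U \<Omega>"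
      unfolding boxing_cover_def by auto
    show ?thesis
    proof (cases "open U")
      case True
      then show ?thesis using cover V(5) by simp
    next
      case False
      have "N1 \<union> N \<in> null_sets lebesgue" using *(1) N' by (rule null_sets.Un)
      moreover have "U - (N1 \<union> N) \<subseteq> (\<Union>i\<in>I. ball (c i) (r i))" using *(4) V(4) by blast
      ultimately show ?thesis unfolding boxing_cover_def
        by (intro bexI[of _ "N1 \<union> N"] conjI impI exI[of _ I] exI[of _ c] exI[of _ r] *(3,5)) (simp_all add: False)
    qed
  qed
  ultimately show thesis by (intro that) blast+
qed

lemma measure_Int_complement_half:
  assumes "B \<in> lmeasurable" "B \<subseteq> \<Omega>" "U \<in> sets lebesgue" "\<not> measure lebesgue (U \<inter> B) \<le> measure lebesgue B / 2"
  shows "measure lebesgue ((\<Omega> - U) \<inter> B) \<le> measure lebesgue B / 2"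
proof -
  have "(\<Omega> - U) \<inter> B = B - U \<inter> B" using assms(2) by auto
  moreover have "measure lebesgue (B - U \<inter> B) = measure lebesgue B - measure lebesgue (U \<inter> B)"
    using assms by (intro measurable_measure_Diff) auto
  ultimately show ?thesis using assms(4) by simp
qed

text \<open>One of U and \<Omega> - U fills at most half of the test ball B and therefore has a
  boxing cover; both have the same energy.\<close>

lemma John_imp_isoperimetric:
  fixes \<Omega> :: "(real ^ 'n) set"
  assumes \<tau>: "0 < \<tau>" "\<tau> < 1" and John: "one_John_domain \<Omega>"
  shows "\<exists>C>0. \<forall>\<delta>\<in>{0<..<1}. isoperimetric_ineq C \<delta> \<tau> \<Omega>"
proof -
  have \<Omega>: "bounded \<Omega>" "open \<Omega>" using John by (auto simp: one_John_domain_def domain_def)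
  obtain C B where C: "C > 0" and B: "B \<in> lmeasurable" "B \<subseteq> \<Omega>" and cover':
    "\<forall>\<delta>\<in>{0<..<1}. \<forall>U\<in>sets lebesgue. U \<subseteq> \<Omega> \<longrightarrow> measure lebesgue (U \<inter> B) \<le> measure lebesgue B / 2
      \<longrightarrow> boxing_cover \<delta> U (ennreal (C * (1 - \<delta>)) * frac_perimeter \<delta> \<tau> U \<Omega>)"
    by (rule John_boxing_cover[OF \<tau> John])
  have cover: "\<And>\<delta> U. \<delta> \<in> {0<..<1} \<Longrightarrow> U \<in> sets lebesgue \<Longrightarrow> U \<subseteq> \<Omega> \<Longrightarrow> measure lebesgue (U \<inter> B) \<le> measure lebesgue B / 2
      \<Longrightarrow> boxing_cover \<delta> U (ennreal (C * (1 - \<delta>)) * frac_perimeter \<delta> \<tau> U \<Omega>)" for \<delta> U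
    using cover' by blast
  have m\<Omega>: "\<Omega> \<in> lmeasurable" using \<Omega> by (intro bounded_set_imp_lmeasurable) auto
  have "isoperimetric_ineq (max 1 (unit_ball_vol (real CARD('n))) * C) \<delta> \<tau> \<Omega>" if \<delta>: "\<delta> \<in> {0<..<1}" for \<delta>
  proof (rule isoperimetric_ineqI[OF _ _ m\<Omega> C])
    fix U assume U: "U \<in> sets lebesgue" "U \<subseteq> \<Omega>"
    have "measure lebesgue (U \<inter> B) \<le> measure lebesgue B / 2 \<or> measure lebesgue ((\<Omega> - U) \<inter> B) \<le> measure lebesgue B / 2"
      using measure_Int_complement_half[OF B U(1)] by auto
    then show "boxing_cover \<delta> U (ennreal (C * (1 - \<delta>)) * frac_perimeter \<delta> \<tau> U \<Omega>) \<or>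
      boxing_cover \<delta> (\<Omega> - U) (ennreal (C * (1 - \<delta>)) * frac_perimeter \<delta> \<tau> U \<Omega>)"
      using cover[OF \<delta> U] cover[OF \<delta> fmeasurableD[OF fmeasurable_Diff[OF m\<Omega> U(1)]]]
      by (auto simp: frac_perimeter_complement)
  qed (use \<delta> in auto)
  then show ?thesis using C by (intro exI[of _ "max 1 (unit_ball_vol (real CARD('n))) * C"]) auto
qed

text \<open>If U fills more than half of the test ball, the cover obtained is one of \<Omega> - U,
  and it bounds the volume of \<Omega> - U by the energy. This volume is at least (1 - \<gamma>)
  |\<Omega>| > 0, so the energy is bounded below and can pay for a single ball containing \<Omega>.
  The exchange rate \<open>h\<close> is the reason why the constant depends on \<gamma>.\<close>

lemma John_imp_boxing:
  fixes \<Omega> :: "(real ^ 'n) set"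
  assumes \<tau>: "0 < \<tau>" "\<tau> < 1" and \<delta>: "0 < \<delta>" "\<delta> < 1" and John: "one_John_domain \<Omega>"
  shows "boxing_inequality \<delta> \<tau> \<Omega>"
proof -
  have \<Omega>: "bounded \<Omega>" "open \<Omega>" "\<Omega> \<noteq> {}" using John by (auto simp: one_John_domain_def domain_def)
  have m\<Omega>: "\<Omega> \<in> lmeasurable" using \<Omega> by (intro bounded_set_imp_lmeasurable) auto
  obtain C B where C: "C > 0" and B: "B \<in> lmeasurable" "B \<subseteq> \<Omega>" and cover':
    "\<forall>\<delta>\<in>{0<..<1}. \<forall>U\<in>sets lebesgue. U \<subseteq> \<Omega> \<longrightarrow> measure lebesgue (U \<inter> B) \<le> measure lebesgue B / 2
      \<longrightarrow> boxing_cover \<delta> U (ennreal (C * (1 - \<delta>)) * frac_perimeter \<delta> \<tau> U \<Omega>)"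
    by (rule John_boxing_cover[OF \<tau> John])
  have cover: "\<And>\<delta> U. \<delta> \<in> {0<..<1} \<Longrightarrow> U \<in> sets lebesgue \<Longrightarrow> U \<subseteq> \<Omega> \<Longrightarrow> measure lebesgue (U \<inter> B) \<le> measure lebesgue B / 2
      \<Longrightarrow> boxing_cover \<delta> U (ennreal (C * (1 - \<delta>)) * frac_perimeter \<delta> \<tau> U \<Omega>)" for \<delta> U
    using cover' by blast
  define W where "W = max 1 (unit_ball_vol (real CARD('n)))"
  have "W \<ge> 1" by (simp add: W_def)
  have pos: "measure lebesgue \<Omega> > 0"
    using open_not_negligible[OF \<Omega>(2,3)] m\<Omega> negligible_iff_measure0[of \<Omega>] by (simp add: zero_less_measure_iff)
  obtain p where p: "p \<in> \<Omega>" using \<Omega> by auto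
  obtain R where R: "R > 0" "\<Omega> \<subseteq> ball p R"
    using bounded_subset_ballD[OF \<Omega>(1)] by blast
  let ?p = "(real CARD('n) - \<delta>) / real CARD('n)"
  have "real CARD('n) \<ge> 1" using zero_less_card_finite[where 'a='n] by linarith
  then have "real CARD('n) - \<delta> \<ge> 0" using \<delta> by linarith
  then have p: "?p \<ge> 0" by (rule divide_nonneg_nonneg) simp
  show ?thesis
    unfolding boxing_inequality_def boxing_cover_def[symmetric]
  proof (intro ballI)
    fix \<gamma> :: real assume \<gamma>: "\<gamma> \<in> {0<..<1}"
    define m where "m = ((1 - \<gamma>) * measure lebesgue \<Omega>) powr ?p"
    have m: "m > 0" using pos \<gamma> by (simp add: m_def)
    define h where "h = R powr (real CARD('n) - \<delta>) / m"
    have h: "h > 0" using R m by (simp add: h_def)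
    have "boxing_cover \<delta> U (ennreal (max C (h * W * C) * (1 - \<delta>)) * frac_perimeter \<delta> \<tau> U \<Omega>)"
      if U: "U \<in> sets lebesgue" "U \<subseteq> \<Omega>" "measure lebesgue U / measure lebesgue \<Omega> \<le> \<gamma>" for U
    proof (cases "measure lebesgue (U \<inter> B) \<le> measure lebesgue B / 2")
      case True
      have "ennreal (C * (1 - \<delta>)) * frac_perimeter \<delta> \<tau> U \<Omega> \<le> ennreal (max C (h * W * C) * (1 - \<delta>)) * frac_perimeter \<delta> \<tau> U \<Omega>"
        using \<delta> by (intro mult_right_mono ennreal_leI) auto
      moreover have "boxing_cover \<delta> U (ennreal (C * (1 - \<delta>)) * frac_perimeter \<delta> \<tau> U \<Omega>)"
        using cover[OF _ U(1,2) True] \<delta> by auto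
      ultimately show ?thesis using boxing_cover_mono by blast
    next
      case False
      have half: "measure lebesgue ((\<Omega> - U) \<inter> B) \<le> measure lebesgue B / 2"
        using measure_Int_complement_half[OF B U(1) False] .
      have D: "\<Omega> - U \<in> lmeasurable" using m\<Omega> U(1) by (rule fmeasurable_Diff)
      have "boxing_cover \<delta> (\<Omega> - U) (ennreal (C * (1 - \<delta>)) * frac_perimeter \<delta> \<tau> U \<Omega>)"
        using cover[OF _ fmeasurableD[OF D] _ half] \<delta> by (auto simp: frac_perimeter_complement)
      from measure_powr_le_boxing_cover[OF \<delta> D this]
      have le: "ennreal (measure lebesgue (\<Omega> - U) powr ?p) \<le> ennreal W * (ennreal (C * (1 - \<delta>)) * frac_perimeter \<delta> \<tau> U \<Omega>)"
        by (simp add: W_def)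
      have "measure lebesgue (\<Omega> - U) = measure lebesgue \<Omega> - measure lebesgue U"
        using U m\<Omega> by (intro measurable_measure_Diff) auto
      also have "\<dots> \<ge> (1 - \<gamma>) * measure lebesgue \<Omega>"
        using U(3) pos by (simp add: field_simps)
      finally have "m \<le> measure lebesgue (\<Omega> - U) powr ?p"
        unfolding m_def using \<gamma> p by (intro powr_mono2) auto
      then have "ennreal m \<le> ennreal W * (ennreal (C * (1 - \<delta>)) * frac_perimeter \<delta> \<tau> U \<Omega>)"
        using le ennreal_leI order_trans by blast
      then have "ennreal h * ennreal m \<le> ennreal h * (ennreal W * (ennreal (C * (1 - \<delta>)) * frac_perimeter \<delta> \<tau> U \<Omega>))"
        by (rule mult_left_mono) simp
      moreover have "ennreal h * ennreal m = ennreal (R powr (real CARD('n) - \<delta>))"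
        using h m by (simp add: ennreal_mult[symmetric] h_def)
      moreover have "ennreal h * (ennreal W * (ennreal (C * (1 - \<delta>)) * frac_perimeter \<delta> \<tau> U \<Omega>))
          = ennreal (h * W * C * (1 - \<delta>)) * frac_perimeter \<delta> \<tau> U \<Omega>"
      proof -
        have "ennreal (h * W * C * (1 - \<delta>)) = ennreal h * (ennreal W * ennreal (C * (1 - \<delta>)))"
          using h \<open>W \<ge> 1\<close> C \<delta> by (simp add: ennreal_mult[symmetric] mult.assoc)
        then show ?thesis by (simp only: mult.assoc)
      qed
      moreover have "ennreal (h * W * C * (1 - \<delta>)) * frac_perimeter \<delta> \<tau> U \<Omega> \<le> ennreal (max C (h * W * C) * (1 - \<delta>)) * frac_perimeter \<delta> \<tau> U \<Omega>"
        using \<delta> by (intro mult_right_mono ennreal_leI) auto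
      ultimately have "ennreal (R powr (real CARD('n) - \<delta>)) \<le> ennreal (max C (h * W * C) * (1 - \<delta>)) * frac_perimeter \<delta> \<tau> U \<Omega>"
        by simp
      then have "(\<Sum>i\<in>F. ennreal (R powr (real CARD('n) - \<delta>))) \<le> ennreal (max C (h * W * C) * (1 - \<delta>)) * frac_perimeter \<delta> \<tau> U \<Omega>"
        if "F \<subseteq> {()}" for F
        using that by (cases "F = {}") (auto simp: subset_singleton_iff)
      then show ?thesis
        using R U(2) by (intro boxing_coverI_countable[of "{}" U "{()}" "\<lambda>_. R" "\<lambda>_. p"]) auto
    qed
    then show "\<exists>C>0. \<forall>U\<in>sets lebesgue. U \<subseteq> \<Omega> \<and> measure lebesgue U / measure lebesgue \<Omega> \<le> \<gamma> \<longrightarrow>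
        boxing_cover \<delta> U (ennreal (C * (1 - \<delta>)) * frac_perimeter \<delta> \<tau> U \<Omega>)"
      using C by (intro exI[of _ "max C (h * W * C)"]) auto
  qed
qed

text \<open>With \<gamma> = 1/2 at least one of U and \<Omega> - U always satisfies the volume
  condition of the boxing inequality.\<close>

lemma boxing_imp_isoperimetric:
  fixes \<Omega> :: "(real ^ 'n) set"
  assumes \<delta>: "0 < \<delta>" "\<delta> < 1" and \<Omega>: "domain \<Omega>" "bounded \<Omega>" and box: "boxing_inequality \<delta> \<tau> \<Omega>"
  shows "\<exists>C>0. isoperimetric_ineq C \<delta> \<tau> \<Omega>"
proof -
  have \<Omega>': "open \<Omega>" "\<Omega> \<noteq> {}" using \<Omega> by (auto simp: domain_def)
  have m\<Omega>: "\<Omega> \<in> lmeasurable" using \<Omega> \<Omega>' by (intro bounded_set_imp_lmeasurable) auto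
  have pos: "measure lebesgue \<Omega> > 0"
    using open_not_negligible[OF \<Omega>'] m\<Omega> negligible_iff_measure0[of \<Omega>] by (simp add: zero_less_measure_iff)
  obtain C where C: "C > 0" and cover: "\<And>U. U \<in> sets lebesgue \<Longrightarrow> U \<subseteq> \<Omega> \<Longrightarrow>
      measure lebesgue U / measure lebesgue \<Omega> \<le> 1 / 2 \<Longrightarrow> boxing_cover \<delta> U (ennreal (C * (1 - \<delta>)) * frac_perimeter \<delta> \<tau> U \<Omega>)"
    using bspec[OF box[unfolded boxing_inequality_def boxing_cover_def[symmetric]], of "1 / 2"] by auto
  have "isoperimetric_ineq (max 1 (unit_ball_vol (real CARD('n))) * C) \<delta> \<tau> \<Omega>"
  proof (rule isoperimetric_ineqI[OF \<delta> m\<Omega> C])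
    fix U assume U: "U \<in> sets lebesgue" "U \<subseteq> \<Omega>"
    have "measure lebesgue (\<Omega> - U) = measure lebesgue \<Omega> - measure lebesgue U"
      using U m\<Omega> by (intro measurable_measure_Diff) auto
    then have "measure lebesgue U / measure lebesgue \<Omega> \<le> 1 / 2 \<or> measure lebesgue (\<Omega> - U) / measure lebesgue \<Omega> \<le> 1 / 2"
      using pos by (auto simp: field_simps)
    then show "boxing_cover \<delta> U (ennreal (C * (1 - \<delta>)) * frac_perimeter \<delta> \<tau> U \<Omega>) \<or>
      boxing_cover \<delta> (\<Omega> - U) (ennreal (C * (1 - \<delta>)) * frac_perimeter \<delta> \<tau> U \<Omega>)"
      using cover[OF U] cover[OF fmeasurableD[OF fmeasurable_Diff[OF m\<Omega> U(1)]]]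
      by (auto simp: frac_perimeter_complement)
  qed
  then show ?thesis using C by (intro exI[of _ "max 1 (unit_ball_vol (real CARD('n))) * C"]) auto
qed

subsection \<open>Averaging over levels\<close>

text \<open>The kernel is |h| powr (1 - n - \<delta>) near 0 and |h| powr (-n - \<delta>) at
  infinity. On dyadic annuli it is dominated by multiples of indicators of balls, \<open>A k\<close>
  inside the unit ball and \<open>B k\<close> outside. Their integrals form geometric series with
  ratios 2 powr -(1 - \<delta>) and 2 powr -\<delta>, both below 1.\<close>

lemma nn_integral_min_kernel_unit:
  fixes \<delta> :: real
  assumes \<delta>: "0 < \<delta>" "\<delta> < 1"
  shows "(\<integral>\<^sup>+(h::'a::euclidean_space). ennreal (min (norm h) 1 / norm h powr (real DIM('a) + \<delta>)) \<partial>lborel) < \<infinity>"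
proof -
  define n where "n = DIM('a)"
  define q where "q = real n + \<delta>"
  define \<omega> where "\<omega> = unit_ball_vol (real n)"
  have n: "real n \<ge> 1" using DIM_positive[where 'a='a] unfolding n_def by linarith
  have q: "q \<ge> 1" using n \<delta> by (simp add: q_def)
  have \<omega>: "\<omega> > 0" by (simp add: \<omega>_def)
  define A :: "nat \<Rightarrow> 'a \<Rightarrow> ennreal" where
    "A k h = ennreal (2 powr (real (k + 1) * (q - 1))) * indicator (ball 0 ((1/2) ^ k)) h" for k h
  define B :: "nat \<Rightarrow> 'a \<Rightarrow> ennreal" where
    "B k h = ennreal (2 powr (- (real k * q))) * indicator (ball 0 (2 ^ (k + 1))) h" for k h
  have pt: "ennreal (min (norm h) 1 / norm h powr q) \<le> (\<Sum>k. A k h + B k h)" for h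
  proof (cases "h = 0")
    case False
    define s where "s = norm h"
    have s: "s > 0" using False by (simp add: s_def)
    obtain k where k: "ennreal (min s 1 / s powr q) \<le> A k h + B k h"
    proof (cases "s < 1")
      case True
      obtain N where "(1/2::real) ^ N < s" using real_arch_pow_inv[OF s, of "1/2"] by auto
      then obtain m where m: "\<forall>i<m. \<not> (1/2::real) ^ i < s" "(1/2::real) ^ m < s"
        using ex_least_nat_le[of "\<lambda>i. (1/2::real) ^ i < s" N] by auto
      have "m \<noteq> 0" using m(2) True by (cases m) auto
      then obtain k where mk: "m = Suc k" using not0_implies_Suc by blast
      then have "s \<le> (1/2) ^ k" using m(1) by auto
      \<comment> \<open>The minimal m yields s \<le> (1/2) ^ k, but the open ball in
        \<open>A\<close> needs a strict inequality; when equality holds, the next larger annulus is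
        taken.\<close>
      obtain j where j: "s < (1/2) ^ j" "(1/2) ^ (j + 1) \<le> s"
      proof (cases "s = (1/2) ^ k")
        case True
        then have "k \<noteq> 0" using \<open>s < 1\<close> by (cases k) auto
        then obtain i where "k = Suc i" using not0_implies_Suc by blast
        then show thesis using that[of i] True by simp
      next
        case False
        then show thesis using that[of k] \<open>s \<le> (1/2) ^ k\<close> m(2) mk by simp
      qed
      have "min s 1 / s powr q = s powr - (q - 1)"
        using True s by (simp add: powr_diff powr_minus_divide)
      also have "\<dots> \<le> ((1/2) ^ (j + 1)) powr - (q - 1)"
        using j q by (intro powr_mono2') auto
      also have "((1/2::real) ^ (j + 1)) powr - (q - 1) = 2 powr (real (j + 1) * (q - 1))"
      proof -
        have "2 powr - real (j + 1) = 1 / 2 powr real (j + 1)" by (rule powr_minus_divide)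
        also have "\<dots> = (1/2) ^ (j + 1)" by (subst powr_realpow) (simp, rule power_one_over[symmetric])
        finally have "(1/2::real) ^ (j + 1) = 2 powr - real (j + 1)" by (rule sym)
        then have "((1/2::real) ^ (j + 1)) powr - (q - 1) = 2 powr (- real (j + 1) * - (q - 1))"
          by (simp only: powr_powr)
        then show ?thesis by (simp only: minus_mult_minus)
      qed
      finally have "ennreal (min s 1 / s powr q) \<le> ennreal (2 powr (real (j + 1) * (q - 1)))"
        by (rule ennreal_leI)
      also have "\<dots> = A j h" using j by (simp add: A_def s_def)
      also have "\<dots> \<le> A j h + B j h" by simp
      finally show thesis by (rule that)
    next
      case False
      obtain N where "s < 2 ^ N" using real_arch_pow[of 2 s] by auto
      then obtain m where m: "\<forall>i<m. \<not> s < 2 ^ i" "s < 2 ^ m"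
        using ex_least_nat_le[of "\<lambda>i. s < 2 ^ i" N] by auto
      have "m \<noteq> 0" using m(2) False by (cases m) auto
      then obtain k where mk: "m = Suc k" using not0_implies_Suc by blast
      then have k: "2 ^ k \<le> s" "s < 2 ^ (k + 1)" using m by auto
      have "min s 1 / s powr q = s powr - q" using False by (simp add: powr_minus_divide)
      also have "\<dots> \<le> (2 ^ k) powr - q" using k q by (intro powr_mono2') auto
      also have "((2::real) ^ k) powr - q = 2 powr (- (real k * q))"
        by (simp only: powr_realpow[symmetric] zero_less_numeral powr_powr) simp
      finally have "ennreal (min s 1 / s powr q) \<le> ennreal (2 powr (- (real k * q)))"
        by (rule ennreal_leI)
      also have "\<dots> = B k h" using k by (simp add: B_def s_def)
      also have "\<dots> \<le> A k h + B k h" by simp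
      finally show thesis by (rule that)
    qed
    also have "A k h + B k h = (\<Sum>k\<in>{k}. A k h + B k h)" by simp
    also have "\<dots> \<le> (\<Sum>k. A k h + B k h)" by (rule sum_le_suminf) auto
    finally show ?thesis by (simp add: s_def)
  qed simp
  have A_meas[measurable]: "A k \<in> borel_measurable borel" for k
    unfolding A_def[abs_def] by (rule borel_measurable_times_ennreal) (simp_all add: borel_measurable_indicator)
  have B_meas[measurable]: "B k \<in> borel_measurable borel" for k
    unfolding B_def[abs_def] by (rule borel_measurable_times_ennreal) (simp_all add: borel_measurable_indicator)
  have iA: "(\<integral>\<^sup>+h. A k h \<partial>lborel) = ennreal (\<omega> * 2 powr (q - 1) * (2 powr - (1 - \<delta>)) ^ k)" for k
  proof -
    have "(\<integral>\<^sup>+h. A k h \<partial>lborel) = ennreal (2 powr (real (k + 1) * (q - 1))) * ennreal (\<omega> * ((1/2) ^ k) ^ n)"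
      unfolding A_def by (subst nn_integral_cmult_indicator) (simp_all add: emeasure_ball \<omega>_def n_def)
    also have "\<dots> = ennreal (2 powr (real (k + 1) * (q - 1)) * (\<omega> * ((1/2) ^ k) ^ n))"
      using \<omega> by (intro ennreal_mult[symmetric]) auto
    also have "2 powr (real (k + 1) * (q - 1)) * (\<omega> * ((1/2) ^ k) ^ n) = \<omega> * 2 powr (q - 1) * (2 powr - (1 - \<delta>)) ^ k"
    proof -
      have e1: "((1/2::real) ^ k) ^ n = 2 powr (- (real k * real n))"
      proof -
        have "2 powr (- (real k * real n)) = 1 / 2 powr real (k * n)" by (simp add: powr_minus_divide)
        also have "\<dots> = ((1/2::real) ^ k) ^ n" by (subst powr_realpow) (simp_all add: power_mult power_one_over)
        finally show ?thesis by simp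
      qed
      have e2: "(2 powr - (1 - \<delta>)) ^ k = 2 powr (- (1 - \<delta>) * real k)"
        by (subst powr_realpow[symmetric]) (simp, rule powr_powr)
      have "2 powr (real (k + 1) * (q - 1)) * 2 powr (- (real k * real n)) = 2 powr (q - 1) * 2 powr (- (1 - \<delta>) * real k)"
        by (simp only: powr_add[symmetric], rule arg_cong[where f="(powr) 2"]) (simp add: q_def algebra_simps)
      then show ?thesis
        unfolding e1 e2 mult.left_commute[of _ \<omega>] by (simp only: mult.assoc[of \<omega>])
    qed
    finally show ?thesis .
  qed
  have iB: "(\<integral>\<^sup>+h. B k h \<partial>lborel) = ennreal (\<omega> * 2 ^ n * (2 powr - \<delta>) ^ k)" for k
  proof -
    have "(\<integral>\<^sup>+h. B k h \<partial>lborel) = ennreal (2 powr (- (real k * q))) * ennreal (\<omega> * (2 ^ (k + 1)) ^ n)"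
      unfolding B_def by (subst nn_integral_cmult_indicator) (simp_all add: emeasure_ball \<omega>_def n_def)
    also have "\<dots> = ennreal (2 powr (- (real k * q)) * (\<omega> * (2 ^ (k + 1)) ^ n))"
      using \<omega> by (intro ennreal_mult[symmetric]) auto
    also have "2 powr (- (real k * q)) * (\<omega> * (2 ^ (k + 1)) ^ n) = \<omega> * 2 ^ n * (2 powr - \<delta>) ^ k"
    proof -
      have e1: "((2::real) ^ (k + 1)) ^ n = 2 ^ n * 2 powr (real k * real n)"
      proof -
        have "2 powr (real k * real n) = 2 powr real (k * n)" by simp
        also have "\<dots> = (2::real) ^ (k * n)" by (rule powr_realpow) simp
        finally show ?thesis by (simp add: power_mult[symmetric] power_add[symmetric])
      qed
      have e2: "(2 powr - \<delta>) ^ k = 2 powr (- \<delta> * real k)"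
        by (subst powr_realpow[symmetric]) (simp, rule powr_powr)
      have "2 powr (- (real k * q)) * 2 powr (real k * real n) = 2 powr (- \<delta> * real k)"
        by (simp only: powr_add[symmetric], rule arg_cong[where f="(powr) 2"]) (simp add: q_def algebra_simps)
      moreover have "a * (w * (t * b)) = w * t * (a * b)" for a b w t :: real by simp
      ultimately show ?thesis unfolding e1 e2 by (simp only:)
    qed
    finally show ?thesis .
  qed
  have x: "0 < (2::real) powr - s" "(2::real) powr - s < 1" if "s > 0" for s :: real
    using that by (auto simp: powr_less_one)
  have sumA: "summable (\<lambda>k. \<omega> * 2 powr (q - 1) * (2 powr - (1 - \<delta>)) ^ k)"
    using x[of "1 - \<delta>"] \<delta> by (intro summable_mult summable_geometric) auto
  have sumB: "summable (\<lambda>k. \<omega> * 2 ^ n * (2 powr - \<delta>) ^ k)"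
    using x[of \<delta>] \<delta> by (intro summable_mult summable_geometric) auto
  have "(\<integral>\<^sup>+(h::'a). ennreal (min (norm h) 1 / norm h powr q) \<partial>lborel) \<le> (\<integral>\<^sup>+h. (\<Sum>k. A k h + B k h) \<partial>lborel)"
    by (intro nn_integral_mono pt)
  also have "\<dots> = (\<Sum>k. \<integral>\<^sup>+h. A k h + B k h \<partial>lborel)"
    by (rule nn_integral_suminf) (simp add: A_meas B_meas)
  also have "\<dots> = (\<Sum>k. ennreal (\<omega> * 2 powr (q - 1) * (2 powr - (1 - \<delta>)) ^ k + \<omega> * 2 ^ n * (2 powr - \<delta>) ^ k))"
  proof (rule suminf_cong)
    fix k
    have "(\<integral>\<^sup>+h. A k h + B k h \<partial>lborel) = (\<integral>\<^sup>+h. A k h \<partial>lborel) + (\<integral>\<^sup>+h. B k h \<partial>lborel)"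
      by (rule nn_integral_add) (simp_all add: A_meas B_meas)
    also have "\<dots> = ennreal (\<omega> * 2 powr (q - 1) * (2 powr - (1 - \<delta>)) ^ k + \<omega> * 2 ^ n * (2 powr - \<delta>) ^ k)"
      unfolding iA iB using \<omega> by (intro ennreal_plus[symmetric]) auto
    finally show "(\<integral>\<^sup>+h. A k h + B k h \<partial>lborel)
      = ennreal (\<omega> * 2 powr (q - 1) * (2 powr - (1 - \<delta>)) ^ k + \<omega> * 2 ^ n * (2 powr - \<delta>) ^ k)" .
  qed
  also have "\<dots> < \<infinity>"
    using summable_add[OF sumA sumB] \<omega> by (subst suminf_ennreal2) auto
  finally show ?thesis by (simp add: q_def n_def)
qed

text \<open>Scaling by L: the volume element contributes L ^ n and the kernel L powr (1 - n -
  \<delta>). The summand 1 in the constant only makes it positive.\<close>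

lemma nn_integral_min_kernel:
  fixes \<delta> :: real
  assumes \<delta>: "0 < \<delta>" "\<delta> < 1"
  obtains K where "K > 0" "\<forall>L>0. (\<integral>\<^sup>+(h::'a::euclidean_space). ennreal (min (norm h) L / norm h powr (real DIM('a) + \<delta>)) \<partial>lborel)
    \<le> ennreal (K * L powr (1 - \<delta>))"
proof -
  define q where "q = real DIM('a) + \<delta>"
  obtain k where k: "k \<ge> 0" "(\<integral>\<^sup>+(h::'a). ennreal (min (norm h) 1 / norm h powr q) \<partial>lborel) = ennreal k"
    using nn_integral_min_kernel_unit[OF \<delta>, where 'a='a] unfolding q_def
    by (cases "\<integral>\<^sup>+(h::'a). ennreal (min (norm h) 1 / norm h powr (real DIM('a) + \<delta>)) \<partial>lborel") auto
  have "(\<integral>\<^sup>+(h::'a). ennreal (min (norm h) L / norm h powr q) \<partial>lborel) \<le> ennreal ((k + 1) * L powr (1 - \<delta>))" if L: "L > 0" for L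
  proof -
    have "(\<integral>\<^sup>+(h::'a). ennreal (min (norm h) L / norm h powr q) \<partial>lborel)
        = ennreal (L ^ DIM('a)) * (\<integral>\<^sup>+(h::'a). ennreal (min (norm (L *\<^sub>R h)) L / norm (L *\<^sub>R h) powr q) \<partial>lborel)"
      using L by (intro nn_integral_lborel_scale) auto
    also have "(\<integral>\<^sup>+(h::'a). ennreal (min (norm (L *\<^sub>R h)) L / norm (L *\<^sub>R h) powr q) \<partial>lborel)
        = (\<integral>\<^sup>+(h::'a). ennreal (L powr (1 - q)) * ennreal (min (norm h) 1 / norm h powr q) \<partial>lborel)"
    proof (rule nn_integral_cong)
      fix h :: 'a
      have "min (norm (L *\<^sub>R h)) L = L * min (norm h) 1" using L by (simp add: min_mult_distrib_left)
      moreover have "norm (L *\<^sub>R h) powr q = L powr q * norm h powr q" using L by (simp add: powr_mult)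
      moreover have "L powr (1 - q) = L / L powr q" using L by (simp add: powr_diff)
      ultimately have "min (norm (L *\<^sub>R h)) L / norm (L *\<^sub>R h) powr q = L powr (1 - q) * (min (norm h) 1 / norm h powr q)"
        by simp
      then show "ennreal (min (norm (L *\<^sub>R h)) L / norm (L *\<^sub>R h) powr q) = ennreal (L powr (1 - q)) * ennreal (min (norm h) 1 / norm h powr q)"
        by (simp only:) (rule ennreal_mult, auto)
    qed
    also have "\<dots> = ennreal (L powr (1 - q)) * ennreal k"
      using k by (subst nn_integral_cmult) auto
    also have "ennreal (L ^ DIM('a)) * (ennreal (L powr (1 - q)) * ennreal k) = ennreal (L ^ DIM('a) * L powr (1 - q) * k)"
      using L k by (simp add: ennreal_mult mult.assoc)
    also have "L ^ DIM('a) * L powr (1 - q) = L powr (1 - \<delta>)"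
      using L by (simp add: powr_realpow[symmetric] powr_add[symmetric] q_def)
    also have "ennreal (L powr (1 - \<delta>) * k) \<le> ennreal ((k + 1) * L powr (1 - \<delta>))"
      by (intro ennreal_leI) (simp add: algebra_simps)
    finally show ?thesis .
  qed
  then show thesis using that[of "k + 1"] k by (auto simp: q_def)
qed

text \<open>For two points of D the condition on \<rho> says that exactly one of them lies outside
  \<open>cball z \<rho>\<close>. So for q = n + \<delta> this is the fractional perimeter of D -
  \<open>cball z \<rho>\<close> relative to D, without truncation. In terms of distances it is
  jointly measurable in x, y and \<rho>, as Tonelli requires.\<close>

definition level_energy :: "real \<Rightarrow> 'a::euclidean_space set \<Rightarrow> 'a \<Rightarrow> real \<Rightarrow> ennreal" where
  "level_energy q D z \<rho> = (\<integral>\<^sup>+y. \<integral>\<^sup>+x.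
     (if x \<in> D \<and> y \<in> D \<and> min (dist z x) (dist z y) \<le> \<rho> \<and> \<rho> < max (dist z x) (dist z y)
      then ennreal (1 / norm (x - y) powr q) else 0) \<partial>lborel \<partial>lborel)"

text \<open>By Tonelli, a pair \<open>(x, y)\<close> contributes the length of the set of levels that separate
  \<open>x\<close> from \<open>y\<close>; this length is at most \<open>norm (x - y)\<close>, which makes the kernel integrable.\<close>

lemma nn_integral_level_energy_le:
  fixes D S :: "'a::euclidean_space set"
  assumes [measurable]: "D \<in> sets borel" "S \<in> sets borel" and "a < b" and q: "q = real DIM('a) + \<delta>"
    and K: "K > 0" "\<forall>L>0. (\<integral>\<^sup>+(h::'a). ennreal (min (norm h) L / norm h powr (real DIM('a) + \<delta>)) \<partial>lborel) \<le> ennreal (K * L powr (1 - \<delta>))"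
    and S: "\<And>x y. x \<in> D \<Longrightarrow> y \<in> D \<Longrightarrow> min (dist z x) (dist z y) \<le> b \<Longrightarrow> a < max (dist z x) (dist z y) \<Longrightarrow> x \<in> S \<or> y \<in> S"
  shows "(\<integral>\<^sup>+\<rho>\<in>{a..b}. level_energy q D z \<rho> \<partial>lborel) \<le> 2 * (emeasure lborel S * ennreal (K * (b - a) powr (1 - \<delta>)))"
proof -
  define E :: "'a \<Rightarrow> 'a \<Rightarrow> real \<Rightarrow> ennreal" where "E x y \<rho> = 
     (if x \<in> D \<and> y \<in> D \<and> min (dist z x) (dist z y) \<le> \<rho> \<and> \<rho> < max (dist z x) (dist z y)
      then ennreal (1 / norm (x - y) powr q) else 0) * indicator {a..b} \<rho>" for x y \<rho>
  let ?k = "\<lambda>(x::'a) (y::'a). ennreal (min (norm (x - y)) (b - a) / norm (x - y) powr q)"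
  \<comment> \<open>The separating levels in [a, b] have length at most |x - y| and at most b - a.
    The pair is charged to whichever of its points lies in S, which produces the final factor 2 and
    bounds the integral by the volume of S.\<close>
  have len: "(\<integral>\<^sup>+\<rho>. E x y \<rho> \<partial>lborel) \<le> indicator S y * ?k x y + indicator S x * ?k x y" for x y
  proof (cases "x \<in> D \<and> y \<in> D \<and> min (dist z x) (dist z y) \<le> b \<and> a < max (dist z x) (dist z y)")
    case True
    define m where "m = min (dist z x) (dist z y)"
    define M where "M = max (dist z x) (dist z y)"
    have mM: "m \<le> M" "M - m \<le> norm (x - y)"
      using dist_triangle[of z x y] dist_triangle[of z y x] by (auto simp: m_def M_def dist_norm[symmetric] dist_commute)
    have "(\<integral>\<^sup>+\<rho>. E x y \<rho> \<partial>lborel) = (\<integral>\<^sup>+\<rho>. ennreal (1 / norm (x - y) powr q) * indicator ({m..<M} \<inter> {a..b}) \<rho> \<partial>lborel)"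
      using True by (intro nn_integral_cong) (auto simp: E_def m_def M_def indicator_def)
    also have "\<dots> = ennreal (1 / norm (x - y) powr q) * emeasure lborel ({m..<M} \<inter> {a..b})"
      by (rule nn_integral_cmult_indicator) simp
    also have "emeasure lborel ({m..<M} \<inter> {a..b}) \<le> ennreal (min (norm (x - y)) (b - a))"
    proof -
      have "emeasure lborel ({m..<M} \<inter> {a..b}) \<le> emeasure lborel {m..<M}" by (intro emeasure_mono) auto
      then have "emeasure lborel ({m..<M} \<inter> {a..b}) \<le> ennreal (norm (x - y))"
        using mM ennreal_leI[OF mM(2)] by (simp add: order_trans)
      moreover have "emeasure lborel ({m..<M} \<inter> {a..b}) \<le> emeasure lborel {a..b}" by (intro emeasure_mono) auto
      ultimately show ?thesis using \<open>a < b\<close> by (simp add: min_def)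
    qed
    also have "ennreal (1 / norm (x - y) powr q) * ennreal (min (norm (x - y)) (b - a)) = ?k x y"
      using \<open>a < b\<close> by (subst ennreal_mult[symmetric]) auto
    also have "?k x y \<le> indicator S y * ?k x y + indicator S x * ?k x y"
      using S[of x y] True by (auto simp: indicator_def)
    finally show ?thesis by (simp add: mult_left_mono)
  next
    case False
    then have "E x y \<rho> = 0" for \<rho> by (auto simp: E_def indicator_def)
    then show ?thesis by simp
  qed
  have kernel: "(\<integral>\<^sup>+x. ?k x y \<partial>lborel) \<le> ennreal (K * (b - a) powr (1 - \<delta>))" for y
  proof -
    have "(\<integral>\<^sup>+x. ?k x y \<partial>lborel) = (\<integral>\<^sup>+h. ?k (y + h) y \<partial>lborel)"
      by (rule nn_integral_lborel_translate[symmetric]) measurable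
    also have "\<dots> \<le> ennreal (K * (b - a) powr (1 - \<delta>))"
      using K(2) \<open>a < b\<close> by (simp add: q)
    finally show ?thesis .
  qed
  have half: "(\<integral>\<^sup>+y. \<integral>\<^sup>+x. indicator S y * ?k x y \<partial>lborel \<partial>lborel) \<le> emeasure lborel S * ennreal (K * (b - a) powr (1 - \<delta>))"
  proof -
    have "(\<integral>\<^sup>+y. \<integral>\<^sup>+x. indicator S y * ?k x y \<partial>lborel \<partial>lborel) = (\<integral>\<^sup>+y. indicator S y * (\<integral>\<^sup>+x. ?k x y \<partial>lborel) \<partial>lborel)"
      by (intro nn_integral_cong nn_integral_cmult) measurable
    also have "\<dots> \<le> (\<integral>\<^sup>+y. indicator S y * ennreal (K * (b - a) powr (1 - \<delta>)) \<partial>lborel)"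
      by (intro nn_integral_mono mult_left_mono kernel) simp
    also have "\<dots> = emeasure lborel S * ennreal (K * (b - a) powr (1 - \<delta>))"
      by (subst nn_integral_multc) auto
    finally show ?thesis .
  qed
  have "(\<integral>\<^sup>+\<rho>\<in>{a..b}. level_energy q D z \<rho> \<partial>lborel) = (\<integral>\<^sup>+\<rho>. \<integral>\<^sup>+y. \<integral>\<^sup>+x. E x y \<rho> \<partial>lborel \<partial>lborel \<partial>lborel)"
  proof (rule nn_integral_cong)
    fix \<rho>
    show "level_energy q D z \<rho> * indicator {a..b} \<rho> = (\<integral>\<^sup>+y. \<integral>\<^sup>+x. E x y \<rho> \<partial>lborel \<partial>lborel)"
      by (cases "\<rho> \<in> {a..b}") (simp_all add: level_energy_def E_def)
  qed
  also have "\<dots> = (\<integral>\<^sup>+y. \<integral>\<^sup>+\<rho>. \<integral>\<^sup>+x. E x y \<rho> \<partial>lborel \<partial>lborel \<partial>lborel)"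
    by (rule lborel_pair.Fubini') (unfold E_def, measurable)
  also have "\<dots> = (\<integral>\<^sup>+y. \<integral>\<^sup>+x. \<integral>\<^sup>+\<rho>. E x y \<rho> \<partial>lborel \<partial>lborel \<partial>lborel)"
    by (rule nn_integral_cong, rule lborel_pair.Fubini') (unfold E_def, measurable)
  also have "\<dots> \<le> (\<integral>\<^sup>+y. \<integral>\<^sup>+x. indicator S y * ?k x y + indicator S x * ?k x y \<partial>lborel \<partial>lborel)"
    by (intro nn_integral_mono len)
  also have "\<dots> = (\<integral>\<^sup>+y. \<integral>\<^sup>+x. indicator S y * ?k x y \<partial>lborel \<partial>lborel) + (\<integral>\<^sup>+y. \<integral>\<^sup>+x. indicator S x * ?k x y \<partial>lborel \<partial>lborel)"
    by (subst nn_integral_add, measurable, subst nn_integral_add, measurable)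
  also have "(\<integral>\<^sup>+y. \<integral>\<^sup>+x. indicator S x * ?k x y \<partial>lborel \<partial>lborel) = (\<integral>\<^sup>+x. \<integral>\<^sup>+y. indicator S x * ?k x y \<partial>lborel \<partial>lborel)"
    by (rule lborel_pair.Fubini') measurable
  also have "\<dots> = (\<integral>\<^sup>+y. \<integral>\<^sup>+x. indicator S y * ?k x y \<partial>lborel \<partial>lborel)"
    by (simp add: norm_minus_commute)
  finally show ?thesis using add_mono[OF half half] by (simp add: mult_2)
qed

subsection \<open>Components of the complement of a sphere\<close>

text \<open>The segment from u to v lies in \<Omega>; if it avoids the sphere, v is in the component
  of u. If it meets the sphere at p, then d(w) \<le> d(p) + |w - p| \<le> 2R + |u - v|, whence (1 -
  \<tau>) |u - v| \<le> 2 \<tau> R and u is at distance at most (1 + 2 \<tau> / (1 - \<tau>)) R from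
  z. Both choices of w occur because the truncation uses the boundary distance of only one point of
  the pair.\<close>

lemma component_cross:
  fixes \<Omega> :: "(real ^ 'n) set"
  assumes \<tau>: "0 < \<tau>" "\<tau> < 1" and R: "bdry_dist \<Omega> z \<le> R"
    and D: "D = connected_component_set (\<Omega> - sphere z R) x0"
    and \<rho>: "(1 + 2 * \<tau> / (1 - \<tau>)) * R \<le> \<rho>"
    and u: "u \<in> D" "dist z u > \<rho>" and v: "v \<in> \<Omega>"
    and w: "w = u \<or> w = v" "dist u v < \<tau> * bdry_dist \<Omega> w"
  shows "v \<in> D"
proof (rule ccontr)
  assume "v \<notin> D"
  have u\<Omega>: "u \<in> \<Omega> - sphere z R" using u(1) connected_component_subset unfolding D by blast
  have w\<Omega>: "w \<in> \<Omega>" using w(1) u\<Omega> v by auto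
  have "\<tau> * bdry_dist \<Omega> w \<le> 1 * bdry_dist \<Omega> w"
    using \<tau> bdry_dist_nonneg[of \<Omega> w] by (intro mult_right_mono) auto
  then have uv: "dist u v < bdry_dist \<Omega> w" using w(2) by simp
  have "u \<in> ball w (bdry_dist \<Omega> w)" "v \<in> ball w (bdry_dist \<Omega> w)"
    using w(1) uv zero_le_dist[of u v] by (auto simp: dist_commute simp del: zero_le_dist)
  then have "closed_segment u v \<subseteq> ball w (bdry_dist \<Omega> w)"
    by (rule closed_segment_subset) (rule convex_ball)
  then have seg: "closed_segment u v \<subseteq> \<Omega>" using ball_bdry_dist_subset[OF w\<Omega>] by blast
  have "\<exists>p\<in>closed_segment u v. p \<in> sphere z R"
  proof (rule ccontr)
    assume "\<not> ?thesis"
    then have "closed_segment u v \<subseteq> \<Omega> - sphere z R" using seg by blast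
    then have "connected_component (\<Omega> - sphere z R) u v"
      unfolding connected_component_def by (intro exI[of _ "closed_segment u v"]) auto
    then have "v \<in> D" using u(1) unfolding D mem_Collect_eq by (rule connected_component_trans[rotated])
    then show False using \<open>v \<notin> D\<close> by simp
  qed
  then obtain p where p: "p \<in> closed_segment u v" "dist z p = R" by auto
  have pu: "dist u p \<le> dist u v" "dist v p \<le> dist u v"
    using dist_in_closed_segment[OF p(1)] by (auto simp: dist_commute)
  have "bdry_dist \<Omega> w \<le> bdry_dist \<Omega> p + dist w p" by (rule bdry_dist_triangle)
  also have "\<dots> \<le> (bdry_dist \<Omega> z + dist p z) + dist u v"
    using bdry_dist_triangle[of \<Omega> p z] pu w(1) by auto
  finally have "bdry_dist \<Omega> w \<le> 2 * R + dist u v" using R p(2) by (simp add: dist_commute)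
  then have "\<tau> * bdry_dist \<Omega> w \<le> \<tau> * (2 * R + dist u v)" using \<tau> by (intro mult_left_mono) auto
  then have "dist u v * (1 - \<tau>) \<le> 2 * \<tau> * R" using w(2) by (simp add: algebra_simps)
  then have "dist u v \<le> 2 * \<tau> / (1 - \<tau>) * R" using \<tau> by (simp add: field_simps)
  then have "dist z u \<le> (1 + 2 * \<tau> / (1 - \<tau>)) * R"
    using dist_triangle[of z u p] p(2) pu(1) by (simp add: dist_commute distrib_right)
  then show False using u(2) \<rho> by simp
qed

text \<open>By \<open>component_cross\<close> a counted pair with exactly one point in D -
  \<open>cball z \<rho>\<close> has both points in D, so it is cut by the sphere of radius \<rho>
  alone. Dropping the truncation afterwards only enlarges the integral.\<close>

lemma frac_perimeter_le_level_energy: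
  fixes \<Omega> :: "(real ^ 'n) set"
  assumes \<tau>: "0 < \<tau>" "\<tau> < 1" and R: "bdry_dist \<Omega> z \<le> R"
    and D: "D = connected_component_set (\<Omega> - sphere z R) x0"
    and \<rho>: "(1 + 2 * \<tau> / (1 - \<tau>)) * R \<le> \<rho>"
  shows "frac_perimeter \<delta> \<tau> (D - cball z \<rho>) \<Omega> \<le> level_energy (real CARD('n) + \<delta>) D z \<rho>"
  unfolding frac_perimeter_lborel level_energy_def
proof (rule nn_integral_mono)
  fix y :: "real ^ 'n"
  let ?U = "D - cball z \<rho>" and ?T = "{x \<in> \<Omega>. norm (x - y) < \<tau> * bdry_dist \<Omega> y}"
  let ?k = "\<lambda>x. ennreal (\<bar>indicator ?U x - indicator ?U y\<bar> / norm (x - y) powr (real CARD('n) + \<delta>))"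
  let ?l = "\<lambda>x. if x \<in> D \<and> y \<in> D \<and> min (dist z x) (dist z y) \<le> \<rho> \<and> \<rho> < max (dist z x) (dist z y)
      then ennreal (1 / norm (x - y) powr (real CARD('n) + \<delta>)) else 0"
  have "?k x * indicator ?T x \<le> ?l x" if y: "y \<in> \<Omega>" for x
  proof (cases "x \<in> ?T \<and> (x \<in> ?U \<longleftrightarrow> y \<notin> ?U)")
    case True
    then have x: "x \<in> \<Omega>" "dist x y < \<tau> * bdry_dist \<Omega> y" by (auto simp: dist_norm)
    have "x \<in> D \<and> y \<in> D \<and> min (dist z x) (dist z y) \<le> \<rho> \<and> \<rho> < max (dist z x) (dist z y)"
    proof (cases "x \<in> ?U")
      case xU: True
      then have "y \<in> D" using component_cross[OF \<tau> R D \<rho>, of x y y] x y by auto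
      then show ?thesis using True xU by auto
    next
      case xU: False
      then have "x \<in> D" using component_cross[OF \<tau> R D \<rho>, of y x y] x True by (auto simp: dist_commute)
      then show ?thesis using True xU by auto
    qed
    then have l: "?l x = ennreal (1 / norm (x - y) powr (real CARD('n) + \<delta>))" by simp
    have "?k x * indicator ?T x \<le> ennreal (1 / norm (x - y) powr (real CARD('n) + \<delta>))"
      using True by (auto simp: indicator_def)
    then show ?thesis unfolding l .
  next
    case False
    then have "?k x * indicator ?T x = 0" by (auto simp: indicator_def)
    then show ?thesis by (simp only: zero_le)
  qed
  then show "(\<integral>\<^sup>+x\<in>?T. ?k x \<partial>lborel) * indicator \<Omega> y \<le> (\<integral>\<^sup>+x. ?l x \<partial>lborel)"
    by (cases "y \<in> \<Omega>") (auto intro!: nn_integral_mono)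
qed

text \<open>For every level in [a, b] the isoperimetric inequality is applied to U = D -
  \<open>cball z \<rho>\<close>. Both |U| and |\<Omega> - U| are at least \<kappa> |D -
  \<open>cball z b\<close>|: the first by monotonicity, the second because \<Omega> - D alone has
  volume at least \<kappa> |\<Omega>|. Hence the left side does not depend on the level. Integration
  yields the factor b - a against (b - a) powr (1 - \<delta>), and the quotient is the gain (b - a)
  powr \<delta>.\<close>

lemma component_volume_decay:
  fixes \<Omega> :: "(real ^ 'n) set"
  assumes \<tau>: "0 < \<tau>" "\<tau> < 1" and \<delta>: "0 < \<delta>" "\<delta> < 1" and \<Omega>: "bounded \<Omega>" "open \<Omega>"
    and iso: "isoperimetric_ineq C \<delta> \<tau> \<Omega>" and C: "C > 0"
    and K: "K > 0" "\<forall>L>0. (\<integral>\<^sup>+(h::real ^ 'n). ennreal (min (norm h) L / norm h powr (real DIM(real ^ 'n) + \<delta>)) \<partial>lborel) \<le> ennreal (K * L powr (1 - \<delta>))"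
    and \<kappa>: "0 < \<kappa>" "\<kappa> \<le> 1" "\<kappa> * measure lebesgue \<Omega> \<le> measure lebesgue (\<Omega> - D)"
    and R: "bdry_dist \<Omega> z \<le> R" and D: "D = connected_component_set (\<Omega> - sphere z R) x0"
    and a: "(1 + 2 * \<tau> / (1 - \<tau>)) * R \<le> a" and "a < b"
    and S: "S \<in> sets borel" "S \<in> lmeasurable"
      "\<And>x y. x \<in> D \<Longrightarrow> y \<in> D \<Longrightarrow> min (dist z x) (dist z y) \<le> b \<Longrightarrow> a < max (dist z x) (dist z y) \<Longrightarrow> x \<in> S \<or> y \<in> S"
  shows "(\<kappa> * measure lebesgue (D - cball z b)) powr ((real CARD('n) - \<delta>) / real CARD('n)) * (b - a) powr \<delta>
    \<le> 2 * C * K * measure lebesgue S"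
proof -
  let ?p = "(real CARD('n) - \<delta>) / real CARD('n)"
  let ?q = "real CARD('n) + \<delta>"
  have "real CARD('n) \<ge> 1" using zero_less_card_finite[where 'a='n] by linarith
  then have "real CARD('n) - \<delta> \<ge> 0" using \<delta> by linarith
  then have p: "?p \<ge> 0" by (rule divide_nonneg_nonneg) simp
  have m\<Omega>: "\<Omega> \<in> lmeasurable" using \<Omega> by (intro bounded_set_imp_lmeasurable) auto
  have D\<Omega>: "D \<subseteq> \<Omega>" unfolding D using connected_component_subset by fastforce
  have oD: "open D" unfolding D by (intro open_connected_component open_Diff \<Omega>) auto
  have Dm: "D - cball z \<rho> \<in> lmeasurable" for \<rho>
    using oD D\<Omega> by (intro fmeasurableI2[OF m\<Omega>]) auto
  define v where "v = (\<kappa> * measure lebesgue (D - cball z b)) powr ?p"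
  have pt: "ennreal v \<le> ennreal (C * (1 - \<delta>)) * level_energy ?q D z \<rho>" if \<rho>: "\<rho> \<in> {a..b}" for \<rho>
  proof -
    let ?U = "D - cball z \<rho>"
    have U: "?U \<in> sets lebesgue" "?U \<subseteq> \<Omega>" using fmeasurableD[OF Dm] D\<Omega> by auto
    have le1: "measure lebesgue (D - cball z b) \<le> measure lebesgue ?U"
      using \<rho> by (intro measure_mono_fmeasurable Dm fmeasurableD[OF Dm]) auto
    have "\<kappa> * measure lebesgue (D - cball z b) \<le> 1 * measure lebesgue (D - cball z b)"
      using \<kappa> by (intro mult_right_mono) auto
    then have m1: "\<kappa> * measure lebesgue (D - cball z b) \<le> measure lebesgue ?U" using le1 by simp
    have "measure lebesgue (D - cball z b) \<le> measure lebesgue \<Omega>"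
      using D\<Omega> by (intro measure_mono_fmeasurable m\<Omega> fmeasurableD[OF Dm]) auto
    then have "\<kappa> * measure lebesgue (D - cball z b) \<le> \<kappa> * measure lebesgue \<Omega>" using \<kappa> by (intro mult_left_mono) auto
    also note \<kappa>(3)
    also have "measure lebesgue (\<Omega> - D) \<le> measure lebesgue (\<Omega> - ?U)"
      using U(1) m\<Omega> oD by (intro measure_mono_fmeasurable fmeasurable_Diff) auto
    finally have m2: "\<kappa> * measure lebesgue (D - cball z b) \<le> measure lebesgue (\<Omega> - ?U)" .
    have "v \<le> min (measure lebesgue ?U) (measure lebesgue (\<Omega> - ?U)) powr ?p"
      unfolding v_def using m1 m2 p \<kappa> by (intro powr_mono2) auto
    then have "ennreal v \<le> ennreal (min (measure lebesgue ?U) (measure lebesgue (\<Omega> - ?U)) powr ?p)"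
      by (rule ennreal_leI)
    also have "\<dots> \<le> ennreal (C * (1 - \<delta>)) * frac_perimeter \<delta> \<tau> ?U \<Omega>"
      using iso U unfolding isoperimetric_ineq_def by blast
    also have "\<dots> \<le> ennreal (C * (1 - \<delta>)) * level_energy ?q D z \<rho>"
      using a \<rho> by (intro mult_left_mono frac_perimeter_le_level_energy[OF \<tau> R D]) auto
    finally show ?thesis .
  qed
  have [measurable]: "D \<in> sets borel" using oD by simp
  have meas[measurable]: "level_energy ?q D z \<in> borel_measurable borel"
    unfolding level_energy_def[abs_def] by measurable
  have "ennreal v * ennreal (b - a) = (\<integral>\<^sup>+\<rho>\<in>{a..b}. ennreal v \<partial>lborel)"
    using \<open>a < b\<close> by (simp add: nn_integral_cmult_indicator)
  also have "\<dots> \<le> (\<integral>\<^sup>+\<rho>\<in>{a..b}. ennreal (C * (1 - \<delta>)) * level_energy ?q D z \<rho> \<partial>lborel)"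
    using pt by (intro nn_integral_mono) (auto simp: indicator_def)
  also have "\<dots> = ennreal (C * (1 - \<delta>)) * (\<integral>\<^sup>+\<rho>\<in>{a..b}. level_energy ?q D z \<rho> \<partial>lborel)"
    by (simp only: mult.assoc, rule nn_integral_cmult) measurable
  also have "\<dots> \<le> ennreal (C * (1 - \<delta>)) * (2 * (emeasure lborel S * ennreal (K * (b - a) powr (1 - \<delta>))))"
    using S by (intro mult_left_mono nn_integral_level_energy_le[OF _ S(1) \<open>a < b\<close> _ K]) auto
  also have "emeasure lborel S = ennreal (measure lebesgue S)"
    using emeasure_eq_measure2[OF S(2)] S(1) by simp
  also have "2 * (ennreal (measure lebesgue S) * ennreal (K * (b - a) powr (1 - \<delta>)))
      = ennreal (2 * (measure lebesgue S * (K * (b - a) powr (1 - \<delta>))))"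
    using K(1) by (simp add: ennreal_mult)
  also have "ennreal (C * (1 - \<delta>)) * ennreal (2 * (measure lebesgue S * (K * (b - a) powr (1 - \<delta>))))
      = ennreal (C * (1 - \<delta>) * (2 * (measure lebesgue S * (K * (b - a) powr (1 - \<delta>)))))"
    using C \<delta> K(1) by (intro ennreal_mult[symmetric]) auto
  finally have "ennreal (v * (b - a)) \<le> ennreal (C * (1 - \<delta>) * (2 * (measure lebesgue S * (K * (b - a) powr (1 - \<delta>)))))"
    using \<open>a < b\<close> by (subst ennreal_mult) (auto simp: v_def)
  then have "v * (b - a) \<le> C * (1 - \<delta>) * (2 * (measure lebesgue S * (K * (b - a) powr (1 - \<delta>))))"
    using C \<delta> K(1) by (subst (asm) ennreal_le_iff) auto
  also have "\<dots> \<le> C * 1 * (2 * (measure lebesgue S * (K * (b - a) powr (1 - \<delta>))))"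
    using C \<delta> K(1) by (intro mult_right_mono mult_left_mono) auto
  also have "\<dots> = (2 * C * K * measure lebesgue S) * (b - a) powr (1 - \<delta>)" by simp
  finally have "v * (b - a) powr \<delta> * (b - a) powr (1 - \<delta>) \<le> (2 * C * K * measure lebesgue S) * (b - a) powr (1 - \<delta>)"
    using \<open>a < b\<close> by (simp add: mult.assoc powr_add[symmetric])
  then show ?thesis using \<open>a < b\<close> by (simp add: v_def)
qed

text \<open>De Giorgi iteration: with radii \<open>R * (\<Lambda> + 1 + M * (1 - 2 ^ -k))\<close> the volume of the part of
  the component outside the \<open>k\<close>-th ball is at most \<open>A * R ^ n * 2 ^ (-n k)\<close>, provided \<open>M\<close> is large.\<close>

lemma component_subset_cball:
  fixes \<Omega> :: "(real ^ 'n) set"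
  assumes \<tau>: "0 < \<tau>" "\<tau> < 1" and \<delta>: "0 < \<delta>" "\<delta> < 1" and \<Omega>: "bounded \<Omega>" "open \<Omega>"
    and iso: "isoperimetric_ineq C \<delta> \<tau> \<Omega>" and C: "C > 0" and \<kappa>: "0 < \<kappa>" "\<kappa> \<le> 1"
  obtains Q where "Q > 0" "\<forall>z R x0. 0 < R \<longrightarrow> bdry_dist \<Omega> z \<le> R \<longrightarrow>
    \<kappa> * measure lebesgue \<Omega> \<le> measure lebesgue (\<Omega> - connected_component_set (\<Omega> - sphere z R) x0) \<longrightarrow>
    connected_component_set (\<Omega> - sphere z R) x0 \<subseteq> cball z (Q * R)"
proof -
  define n where "n = real CARD('n)"
  have n: "n \<ge> 1" unfolding n_def using zero_less_card_finite[where 'a='n] by linarith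
  define p where "p = (n - \<delta>) / n"
  have "n - \<delta> > 0" using n \<delta> by linarith
  then have p: "p > 0" using n by (simp add: p_def)
  define \<omega> where "\<omega> = unit_ball_vol n"
  have \<omega>: "\<omega> > 0" using n by (simp add: \<omega>_def)
  obtain K where K: "K > 0" "\<forall>L>0. (\<integral>\<^sup>+(h::real ^ 'n). ennreal (min (norm h) L / norm h powr (real DIM(real ^ 'n) + \<delta>)) \<partial>lborel) \<le> ennreal (K * L powr (1 - \<delta>))"
    by (rule nn_integral_min_kernel[OF \<delta>])
  define \<Lambda> where "\<Lambda> = 1 + 2 * \<tau> / (1 - \<tau>)"
  have \<Lambda>: "\<Lambda> \<ge> 1" using \<tau> by (simp add: \<Lambda>_def)
  \<comment> \<open>Chosen so that (\<kappa> A) powr p is exactly the constant of the case k =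
    0.\<close>
  define A where "A = (2 * C * K * (\<omega> * (\<Lambda> + 2) powr n)) powr (1 / p) / \<kappa>"
  have A: "A > 0" using C K(1) \<omega> \<Lambda> \<kappa> by (simp add: A_def)
  \<comment> \<open>Chosen to satisfy \<open>M\<delta>\<close>: the gain M powr \<delta> from the
    step length absorbs the factor 2 powr n by which the bounds for k and k + 1 differ.\<close>
  define M where "M = (2 * C * K * A * 2 powr n / (\<kappa> * A) powr p) powr (1 / \<delta>)"
  have M: "M > 0" using C K(1) A \<kappa> by (simp add: M_def)
  have M\<delta>: "2 * C * K * A * 2 powr n = (\<kappa> * A) powr p * M powr \<delta>"
    using C K(1) A \<kappa> \<delta> by (simp add: M_def powr_powr)
  have "connected_component_set (\<Omega> - sphere z R) x0 \<subseteq> cball z ((\<Lambda> + 1 + M) * R)"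
    if R: "0 < R" "bdry_dist \<Omega> z \<le> R"
      and large: "\<kappa> * measure lebesgue \<Omega> \<le> measure lebesgue (\<Omega> - connected_component_set (\<Omega> - sphere z R) x0)"
    for z x0 R
  proof -
    define D where "D = connected_component_set (\<Omega> - sphere z R) x0"
    have D\<Omega>: "D \<subseteq> \<Omega>" unfolding D_def using connected_component_subset by fastforce
    have oD: "open D" unfolding D_def by (intro open_connected_component open_Diff \<Omega>) auto
    have m\<Omega>: "\<Omega> \<in> lmeasurable" using \<Omega> by (intro bounded_set_imp_lmeasurable) auto
    have Dm: "D - cball z \<rho> \<in> lmeasurable" for \<rho>
      using oD D\<Omega> by (intro fmeasurableI2[OF m\<Omega>]) auto
    define r where "r k = (\<Lambda> + 1 + M * (1 - (1/2) ^ k)) * R" for k :: nat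
    define V where "V k = measure lebesgue (D - cball z (r k))" for k
    have decay: "(\<kappa> * measure lebesgue (D - cball z b)) powr p * (b - a) powr \<delta> \<le> 2 * C * K * measure lebesgue S"
      if "\<Lambda> * R \<le> a" "a < b" "S \<in> sets borel" "S \<in> lmeasurable"
        "\<And>x y. x \<in> D \<Longrightarrow> y \<in> D \<Longrightarrow> min (dist z x) (dist z y) \<le> b \<Longrightarrow> a < max (dist z x) (dist z y) \<Longrightarrow> x \<in> S \<or> y \<in> S" for a b S
      unfolding p_def n_def
      by (rule component_volume_decay[OF \<tau> \<delta> \<Omega> iso C K \<kappa> _ R(2) D_def])
        (use that large in \<open>auto simp: \<Lambda>_def D_def\<close>)
    have le_A: "v \<le> A * w" if "(\<kappa> * v) powr p \<le> (\<kappa> * (A * w)) powr p" "v \<ge> 0" "w \<ge> 0" for v w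
    proof (rule ccontr)
      assume "\<not> v \<le> A * w"
      then have "\<kappa> * (A * w) < \<kappa> * v" using \<kappa> by simp
      then have "(\<kappa> * (A * w)) powr p < (\<kappa> * v) powr p" using A \<kappa> that p by (intro powr_less_mono2) auto
      then show False using that by simp
    qed
    have V: "V k \<le> A * (R powr n * 2 powr (- n * real k))" for k
    proof (induction k)
      case 0
      have "(\<kappa> * measure lebesgue (D - cball z ((\<Lambda> + 1) * R))) powr p * ((\<Lambda> + 1) * R - \<Lambda> * R) powr \<delta>
          \<le> 2 * C * K * measure lebesgue (ball z ((\<Lambda> + 2) * R))"
      \<comment> \<open>At the start nothing is known about the volume of D, but a counted pair has
        a point within (\<Lambda> + 1) R of z, so S can be a ball; radius (\<Lambda> + 2) R makes it
        open.\<close>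
      proof (rule decay)
        fix x y assume "min (dist z x) (dist z y) \<le> (\<Lambda> + 1) * R"
        moreover have "(\<Lambda> + 1) * R < (\<Lambda> + 2) * R" using R by simp
        ultimately show "x \<in> ball z ((\<Lambda> + 2) * R) \<or> y \<in> ball z ((\<Lambda> + 2) * R)" by (auto simp: min_def split: if_splits)
      qed (use R in auto)
      also have "measure lebesgue (ball z ((\<Lambda> + 2) * R)) = \<omega> * (\<Lambda> + 2) powr n * R powr n"
        using R \<Lambda> by (simp add: content_ball \<omega>_def n_def powr_realpow power_mult_distrib)
      also have "(\<Lambda> + 1) * R - \<Lambda> * R = R" by (simp add: algebra_simps)
      also have "(\<Lambda> + 1) * R = r 0" by (simp add: r_def)
      finally have "(\<kappa> * V 0) powr p * R powr \<delta> \<le> (2 * C * K * (\<omega> * (\<Lambda> + 2) powr n)) * R powr n"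
        by (simp add: V_def mult.assoc)
      also have "R powr n = R powr (n * p) * R powr \<delta>"
        using n by (simp add: p_def powr_add[symmetric])
      also have "2 * C * K * (\<omega> * (\<Lambda> + 2) powr n) = (\<kappa> * A) powr p"
        using C K(1) \<omega> \<Lambda> \<kappa> p by (simp add: A_def powr_powr)
      finally have "(\<kappa> * V 0) powr p * R powr \<delta> \<le> ((\<kappa> * A) powr p * R powr (n * p)) * R powr \<delta>" by (simp add: mult.assoc)
      then have "(\<kappa> * V 0) powr p \<le> (\<kappa> * A) powr p * R powr (n * p)"
        using R by simp
      also have "\<dots> = (\<kappa> * (A * R powr n)) powr p"
        using \<kappa> A R by (simp add: powr_mult powr_powr mult.assoc)
      finally show ?case using le_A[of "V 0" "R powr n"] by (simp add: V_def)
    next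
      case (Suc k)
      have d: "r (Suc k) - r k = M * R * 2 powr (- real (Suc k))"
      proof -
        have "2 powr (- real (Suc k)) = (1/2::real) ^ Suc k"
          by (subst powr_minus_divide, subst powr_realpow) (simp, rule power_one_over[symmetric])
        then show ?thesis by (simp add: r_def algebra_simps)
      qed
      have dpos: "M * R * 2 powr (- real (Suc k)) > 0" using M R by simp
      have "(1/2::real) ^ k \<le> 1" by (rule power_le_one) auto
      then have "\<Lambda> * R \<le> r k" unfolding r_def using M R by (intro mult_right_mono) auto
      then have "(\<kappa> * V (Suc k)) powr p * (r (Suc k) - r k) powr \<delta> \<le> 2 * C * K * V k"
        \<comment> \<open>Here S = D - \<open>cball z (r k)\<close>: of each counted pair the
          farther point has distance greater than r k. This feeds V k into the bound for V (Suc
          k).\<close>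
        unfolding V_def using d dpos oD
        by (intro decay Dm) auto
      also have "\<dots> \<le> 2 * C * K * (A * (R powr n * 2 powr (- n * real k)))"
        using Suc C K(1) by (intro mult_left_mono) auto
      also have "\<dots> = (2 * C * K * A * 2 powr n) * (R powr n * 2 powr (- n * real (Suc k)))"
      proof -
        have "2 powr (- n * real k) = 2 powr n * 2 powr (- n * real (Suc k))"
          by (simp only: powr_add[symmetric], rule arg_cong[where f="(powr) 2"]) (simp add: algebra_simps)
        then show ?thesis by (simp only: mult_ac)
      qed
      also have "\<dots> = (\<kappa> * A) powr p * M powr \<delta> * (R powr n * 2 powr (- n * real (Suc k)))"
        by (simp only: M\<delta>)
      \<comment> \<open>The identity n = n p + \<delta> splits the bound, for R and for the power of
        2 alike, into the p-th power of the next bound and the \<delta>-th power of the step length,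
        which then cancels.\<close>
      also have "R powr n = R powr (n * p) * R powr \<delta>"
        using n by (simp add: p_def powr_add[symmetric])
      also have "2 powr (- n * real (Suc k)) = 2 powr ((- n * real (Suc k)) * p) * 2 powr (- real (Suc k) * \<delta>)"
      proof -
        have "n * p = n - \<delta>" using n by (simp add: p_def)
        then have "(- n * real (Suc k)) * p = - real (Suc k) * (n - \<delta>)" by (metis mult.commute mult.left_commute mult_minus_left)
        then show ?thesis
          by (simp only: powr_add[symmetric], intro arg_cong[where f="(powr) 2"]) (simp add: algebra_simps)
      qed
      also have "(\<kappa> * A) powr p * M powr \<delta> * (R powr (n * p) * R powr \<delta> * (2 powr ((- n * real (Suc k)) * p) * 2 powr (- real (Suc k) * \<delta>)))
          = ((\<kappa> * A) powr p * R powr (n * p) * 2 powr ((- n * real (Suc k)) * p)) * (M * R * 2 powr (- real (Suc k))) powr \<delta>"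
        using M R by (simp only: powr_mult powr_powr mult_ac)
      also have "(\<kappa> * A) powr p * R powr (n * p) * 2 powr ((- n * real (Suc k)) * p) = (\<kappa> * (A * (R powr n * 2 powr (- n * real (Suc k))))) powr p"
        by (simp only: powr_mult powr_powr mult.assoc)
      finally have "(\<kappa> * V (Suc k)) powr p \<le> (\<kappa> * (A * (R powr n * 2 powr (- n * real (Suc k))))) powr p"
        unfolding d by (rule mult_right_le_imp_le) (use M R in simp)
      then show ?case by (intro le_A) (auto simp: V_def)
    qed
    define E where "E = D - cball z ((\<Lambda> + 1 + M) * R)"
    have small: "measure lebesgue E \<le> A * R powr n * (2 powr - n) ^ k" for k
    proof -
      have "1 - (1/2::real) ^ k \<le> 1" by simp
      then have "M * (1 - (1/2) ^ k) \<le> M * 1" using M by (intro mult_left_mono) auto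
      then have "r k \<le> (\<Lambda> + 1 + M) * R" unfolding r_def using R by (intro mult_right_mono) auto
      then have "measure lebesgue E \<le> V k"
        unfolding E_def V_def by (intro measure_mono_fmeasurable Dm fmeasurableD[OF Dm]) auto
      also have "\<dots> \<le> A * (R powr n * 2 powr (- n * real k))" by (rule V)
      also have "2 powr (- n * real k) = (2 powr - n) ^ k"
        by (subst powr_realpow[symmetric]) (simp, rule powr_powr[symmetric])
      finally show ?thesis by (simp add: mult.assoc)
    qed
    have "(\<lambda>k. A * R powr n * (2 powr - n) ^ k) \<longlonglongrightarrow> A * R powr n * 0"
      using n by (intro tendsto_mult tendsto_const LIMSEQ_power_zero) (auto simp: powr_less_one)
    then have "measure lebesgue E \<le> A * R powr n * 0"
      by (rule LIMSEQ_le_const) (use small in auto)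
    then have "measure lebesgue E = 0" using measure_nonneg[of lebesgue E] by simp
    moreover have "E \<in> lmeasurable" unfolding E_def by (rule Dm)
    ultimately have "negligible E" by (simp add: negligible_iff_measure)
    moreover have "open E" unfolding E_def using oD by (intro open_Diff) auto
    \<comment> \<open>A null set that is open is empty, so the volume estimate becomes an
      inclusion.\<close>
    ultimately have "E = {}" using open_not_negligible by blast
    then show ?thesis unfolding E_def D_def by blast
  qed
  moreover have "\<Lambda> + 1 + M > 0" using \<Lambda> M by simp
  ultimately show thesis by (intro that[of "\<Lambda> + 1 + M"]) auto
qed

subsection \<open>Separation implies John\<close>

text \<open>The derivative is bounded on [0, 1], so p is Lipschitz there and the sums over monotone
  partitions telescope to at most B.\<close>

lemma rectifiable_polynomial_function:
  fixes p :: "real \<Rightarrow> real ^ 'n"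
  assumes "polynomial_function p"
  shows "rectifiable p"
proof -
  obtain p' where p': "polynomial_function p'" "\<And>x. (p has_vector_derivative p' x) (at x)"
    using has_vector_derivative_polynomial_function[OF assms] by metis
  have "compact (p' ` {0..1})"
    by (intro compact_continuous_image continuous_on_polymonial_function p') auto
  then obtain B where B: "B > 0" "\<And>x. x \<in> {0..1} \<Longrightarrow> norm (p' x) \<le> B"
    using compact_imp_bounded bounded_pos by (metis imageI)
  have lip: "norm (p x - p y) \<le> B * norm (x - y)" if "x \<in> {0..1}" "y \<in> {0..1}" for x y
  proof (rule differentiable_bound[where S="{0..1}" and f'="\<lambda>x h. h *\<^sub>R p' x"])
    show "(p has_derivative (\<lambda>h. h *\<^sub>R p' x)) (at x within {0..1})" for x
      using p'(2)[of x] by (auto simp: has_vector_derivative_def intro: has_derivative_at_withinI)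
    show "onorm (\<lambda>h. h *\<^sub>R p' x) \<le> B" if "x \<in> {0..1}" for x
      using B(2)[OF that] by (intro onorm_le) (simp, subst mult.commute, intro mult_right_mono, auto)
  qed (use that in auto)
  have "(\<Sum>i<m. dist (p (t i)) (p (t (Suc i)))) \<le> B" if t: "mono t" "range t \<subseteq> {0..1}" for m and t :: "nat \<Rightarrow> real"
  proof -
    have t01: "t i \<in> {0..1}" for i using t(2) by (rule subsetD) (rule rangeI)
    have "dist (p (t i)) (p (t (Suc i))) \<le> B * (t (Suc i) - t i)" for i
      using lip[OF t01[of "Suc i"] t01[of i]] monoD[OF t(1), of i "Suc i"]
      by (simp add: dist_norm norm_minus_commute)
    then have "(\<Sum>i<m. dist (p (t i)) (p (t (Suc i)))) \<le> (\<Sum>i<m. B * (t (Suc i) - t i))"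
      by (rule sum_mono)
    also have "\<dots> = B * (t m - t 0)"
      by (simp add: sum_distrib_left[symmetric] sum_lessThan_telescope)
    also have "\<dots> \<le> B * 1" using B(1) t01[of m] t01[of 0] by (intro mult_left_mono) auto
    finally show ?thesis by simp
  qed
  then show ?thesis unfolding rectifiable_def by (intro bdd_aboveI[of _ B]) auto
qed

text \<open>A polynomial curve with the same endpoints, closer to g than half the least boundary
  distance along g, stays in \<Omega>. Its boundary distance is at least half that of g, which
  accounts for the factor 2; the displacement accounts for L + 1 in place of L.\<close>

lemma rectifiable_John_curve:
  fixes \<Omega> :: "(real ^ 'n) set"
  assumes \<Omega>: "bounded \<Omega>" "open \<Omega>" and L: "L \<ge> 0" and g: "curve_in \<Omega> x y g"
    and John: "\<And>t. t \<in> {0..1} \<Longrightarrow> norm (g t - x) \<le> L * bdry_dist \<Omega> (g t)"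
  shows "\<exists>p. curve_in \<Omega> x y p \<and> rectifiable p \<and> (\<forall>t\<in>{0..1}. 2 * (L + 1) * bdry_dist \<Omega> (p t) > norm (p t - x))"
proof -
  have g': "path g" "pathstart g = x" "pathfinish g = y" "\<And>t. t \<in> {0..1} \<Longrightarrow> g t \<in> \<Omega>"
    using g by (auto simp: curve_in_def path_image_def)
  have "continuous_on {0..1} (\<lambda>t. bdry_dist \<Omega> (g t))"
    using g'(1) by (intro continuous_on_bdry_dist) (simp add: path_def)
  then obtain s where s: "s \<in> {0..1}" "\<And>t. t \<in> {0..1} \<Longrightarrow> bdry_dist \<Omega> (g s) \<le> bdry_dist \<Omega> (g t)"
    using continuous_attains_inf[of "{0..1::real}" "\<lambda>t. bdry_dist \<Omega> (g t)"] by auto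
  define \<eta> where "\<eta> = bdry_dist \<Omega> (g s) / 2"
  have \<eta>: "\<eta> > 0" using bdry_dist_pos[OF \<Omega> g'(4)[OF s(1)]] by (simp add: \<eta>_def)
  obtain p where p: "polynomial_function p" "pathstart p = x" "pathfinish p = y"
    "\<And>t. t \<in> {0..1} \<Longrightarrow> norm (p t - g t) < \<eta>"
    using path_approx_polynomial_function[OF g'(1) \<eta>] g'(2,3) by metis
  have near: "p t \<in> \<Omega> \<and> 2 * (L + 1) * bdry_dist \<Omega> (p t) > norm (p t - x)" if t: "t \<in> {0..1}" for t
  proof
    have m: "2 * \<eta> \<le> bdry_dist \<Omega> (g t)" using s(2)[OF t] by (simp add: \<eta>_def)
    have pg: "dist (g t) (p t) < \<eta>" using p(4)[OF t] by (simp add: dist_norm norm_minus_commute)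
    then have "p t \<in> ball (g t) (bdry_dist \<Omega> (g t))" using m \<eta> by simp
    then show "p t \<in> \<Omega>" using ball_bdry_dist_subset[OF g'(4)[OF t]] by blast
    have d: "bdry_dist \<Omega> (g t) \<le> 2 * bdry_dist \<Omega> (p t)"
      using bdry_dist_triangle[of \<Omega> "g t" "p t"] pg m by linarith
    have "norm (p t - x) \<le> norm (p t - g t) + norm (g t - x)"
      using norm_triangle_ineq[of "p t - g t" "g t - x"] by simp
    also have "\<dots> < bdry_dist \<Omega> (g t) + L * bdry_dist \<Omega> (g t)"
      using p(4)[OF t] John[OF t] m \<eta> by linarith
    also have "\<dots> = (L + 1) * bdry_dist \<Omega> (g t)" by (simp add: algebra_simps)
    also have "\<dots> \<le> (L + 1) * (2 * bdry_dist \<Omega> (p t))" using d L by (intro mult_left_mono) auto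
    finally show "2 * (L + 1) * bdry_dist \<Omega> (p t) > norm (p t - x)" by (simp only: mult_ac)
  qed
  have "curve_in \<Omega> x y p"
    using p near by (auto simp: curve_in_def path_image_def intro: path_polynomial_function)
  then show ?thesis using near rectifiable_polynomial_function[OF p(1)] by blast
qed

text \<open>The separation property is applied to y = x = g 0, so that beyond radius C0 d(z) the
  component D of x excludes x0. A lower bound for |\<Omega> - D| independent of z comes from a fixed
  ball about x0: if the sphere misses this ball, D does as well. If the sphere meets it, d(z) is at
  least a fixed fraction of d0 and the diameter of \<Omega> gives the estimate. \<open>L\<close>
  adds up the constants of the three cases.\<close>

lemma isoperimetric_separation_imp_John:
  fixes \<Omega> :: "(real ^ 'n) set"
  assumes \<tau>: "0 < \<tau>" "\<tau> < 1" and \<delta>: "0 < \<delta>" "\<delta> < 1" and dom: "domain \<Omega>" "bounded \<Omega>"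
    and sep: "separation_property \<Omega>" and C: "C > 0" and iso: "isoperimetric_ineq C \<delta> \<tau> \<Omega>"
  shows "one_John_domain \<Omega>"
proof -
  have \<Omega>: "bounded \<Omega>" "open \<Omega>" "\<Omega> \<noteq> {}" using dom by (auto simp: domain_def)
  have m\<Omega>: "\<Omega> \<in> lmeasurable" using \<Omega> by (intro bounded_set_imp_lmeasurable) auto
  obtain x0 C0 where x0: "x0 \<in> \<Omega>" and C0: "C0 \<ge> 1" and curves: "\<And>x. x \<in> \<Omega> \<Longrightarrow> \<exists>g. curve_in \<Omega> x x0 g \<and>
        (\<forall>t\<in>{0..1}. let B = ball (g t) (C0 * bdry_dist \<Omega> (g t)) in
             g ` {0..t} \<subseteq> B \<or>
             (\<forall>y \<in> g ` {0..t} - B. \<not> connected_component (\<Omega> - frontier B) y x0))"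
    using sep unfolding separation_property_def by blast
  define d0 where "d0 = bdry_dist \<Omega> x0"
  have d0: "d0 > 0" unfolding d0_def by (rule bdry_dist_pos[OF \<Omega>(1,2) x0])
  \<comment> \<open>Half of d0 leaves room: if the sphere of radius C0 d(z) about z meets this ball,
    then d0/2 \<le> (C0 + 1) d(z).\<close>
  let ?B0 = "ball x0 (d0 / 2)"
  have B0: "?B0 \<subseteq> \<Omega>" using ball_bdry_dist_subset[OF x0] subset_ball[of "d0 / 2" d0 x0] d0 by (auto simp: d0_def)
  have c0: "measure lebesgue ?B0 > 0" using d0 by simp
  have c0\<Omega>: "measure lebesgue ?B0 \<le> measure lebesgue \<Omega>" using B0 m\<Omega> by (intro measure_mono_fmeasurable) auto
  define \<kappa> where "\<kappa> = measure lebesgue ?B0 / measure lebesgue \<Omega>"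
  have \<kappa>: "0 < \<kappa>" "\<kappa> \<le> 1" and \<kappa>\<Omega>: "\<kappa> * measure lebesgue \<Omega> = measure lebesgue ?B0"
    using c0 c0\<Omega> unfolding \<kappa>_def by (auto simp: divide_le_eq simp del: content_ball_gt_0_iff)
  obtain Q where Q: "Q > 0" "\<forall>z R x0. 0 < R \<longrightarrow> bdry_dist \<Omega> z \<le> R \<longrightarrow>
    \<kappa> * measure lebesgue \<Omega> \<le> measure lebesgue (\<Omega> - connected_component_set (\<Omega> - sphere z R) x0) \<longrightarrow>
    connected_component_set (\<Omega> - sphere z R) x0 \<subseteq> cball z (Q * R)"
    by (rule component_subset_cball[OF \<tau> \<delta> \<Omega>(1,2) iso C \<kappa>])
  obtain M where M: "M > 0" "\<forall>x\<in>\<Omega>. bdry_dist \<Omega> x \<le> M" "\<forall>x\<in>\<Omega>. \<forall>y\<in>\<Omega>. dist x y \<le> M"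
    by (rule bdry_dist_bounded[OF \<Omega>(1,3)])
  define L where "L = Q * C0 + C0 + 2 * (C0 + 1) * M / d0"
  have parts: "0 \<le> Q * C0" "0 \<le> C0" "0 \<le> 2 * (C0 + 1) * M / d0" using Q(1) C0 M(1) d0 by auto
  have bound: "dist z x \<le> L * bdry_dist \<Omega> z"
    if z: "z \<in> \<Omega>" and x: "x \<in> \<Omega>" and nc: "x \<notin> ball z (C0 * bdry_dist \<Omega> z) \<Longrightarrow>
      \<not> connected_component (\<Omega> - frontier (ball z (C0 * bdry_dist \<Omega> z))) x x0" for x z
  proof -
    define R where "R = C0 * bdry_dist \<Omega> z"
    have dz: "bdry_dist \<Omega> z > 0" by (rule bdry_dist_pos[OF \<Omega>(1,2) z])
    have R: "R > 0" "bdry_dist \<Omega> z \<le> R" using dz C0 by (auto simp: R_def mult_le_cancel_right1)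
    have mono: "c * bdry_dist \<Omega> z \<le> L * bdry_dist \<Omega> z" if "c \<le> L" for c
      using that dz by (intro mult_right_mono) auto
    show ?thesis
    \<comment> \<open>The case includes points on the sphere itself, which lie in no component of
      its complement.\<close>
    proof (cases "dist z x \<le> R")
      case True
      then show ?thesis using mono[of C0] parts by (simp add: L_def R_def)
    next
      case False
      define D where "D = connected_component_set (\<Omega> - sphere z R) x"
      have xD: "x \<in> D" using x False by (auto simp: D_def connected_component_refl_eq)
      have x0D: "x0 \<notin> D" using nc False R by (auto simp: D_def R_def[symmetric] frontier_ball)
      show ?thesis
      proof (cases "?B0 \<inter> sphere z R = {}")
        case True
        have "?B0 \<inter> D = {}"
        proof (rule ccontr)
          assume "?B0 \<inter> D \<noteq> {}"
          then obtain y where y: "y \<in> ?B0" "y \<in> D" by blast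
          have "connected_component (\<Omega> - sphere z R) y x0"
            unfolding connected_component_def using B0 True y d0 by (intro exI[of _ ?B0]) auto
          then have "x0 \<in> D" using y(2) connected_component_trans unfolding D_def by fastforce
          then show False using x0D by simp
        qed
        then have "?B0 \<subseteq> \<Omega> - D" using B0 by blast
        moreover have "open D" unfolding D_def by (intro open_connected_component open_Diff \<Omega>) auto
        ultimately have "measure lebesgue ?B0 \<le> measure lebesgue (\<Omega> - D)"
          using m\<Omega> by (intro measure_mono_fmeasurable fmeasurable_Diff) auto
        then have "D \<subseteq> cball z (Q * R)" using Q(2) R \<kappa>\<Omega> unfolding D_def by auto
        then have "dist z x \<le> Q * C0 * bdry_dist \<Omega> z" using xD by (auto simp: R_def mult.assoc)
        also have "\<dots> \<le> L * bdry_dist \<Omega> z" using parts by (intro mono) (simp add: L_def)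
        finally show ?thesis .
      next
        case False
        then obtain w where "w \<in> ?B0" "w \<in> sphere z R" by blast
        then have w: "dist x0 w < d0 / 2" "dist z w = R" by simp_all
        have "d0 \<le> bdry_dist \<Omega> z + dist x0 z" unfolding d0_def by (rule bdry_dist_triangle)
        also have "dist x0 z \<le> dist x0 w + dist z w" using dist_triangle[of x0 z w] by (simp add: dist_commute)
        finally have "d0 \<le> 2 * (C0 + 1) * bdry_dist \<Omega> z" using w by (simp add: R_def algebra_simps)
        then have "1 \<le> 2 * (C0 + 1) * bdry_dist \<Omega> z / d0" using d0 by simp
        then have "M * 1 \<le> M * (2 * (C0 + 1) * bdry_dist \<Omega> z / d0)" using M(1) by (intro mult_left_mono) auto
        moreover have "dist z x \<le> M" using M(3) z x by blast
        ultimately have "dist z x \<le> 2 * (C0 + 1) * M / d0 * bdry_dist \<Omega> z" by (simp add: mult_ac)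
        also have "\<dots> \<le> L * bdry_dist \<Omega> z" using parts by (intro mono) (simp add: L_def)
        finally show ?thesis .
      qed
    qed
  qed
  have L: "L \<ge> 0" using parts by (simp add: L_def)
  have "\<exists>p. curve_in \<Omega> x x0 p \<and> rectifiable p \<and> (\<forall>t\<in>{0..1}. 2 * (L + 1) * bdry_dist \<Omega> (p t) > norm (p t - x))"
    if x: "x \<in> \<Omega>" for x
  proof -
    obtain g where g: "curve_in \<Omega> x x0 g" and *: "\<And>t. t \<in> {0..1} \<Longrightarrow>
      g ` {0..t} \<subseteq> ball (g t) (C0 * bdry_dist \<Omega> (g t)) \<or>
      (\<forall>y \<in> g ` {0..t} - ball (g t) (C0 * bdry_dist \<Omega> (g t)). \<not> connected_component (\<Omega> - frontier (ball (g t) (C0 * bdry_dist \<Omega> (g t)))) y x0)"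
      using curves[OF x] unfolding Let_def by blast
    have "norm (g t - x) \<le> L * bdry_dist \<Omega> (g t)" if t: "t \<in> {0..1}" for t
    proof -
      have "g 0 = x" "g t \<in> \<Omega>" using g t by (auto simp: curve_in_def pathstart_def path_image_def)
      then have "x \<in> g ` {0..t}" using t by force
      then have "dist (g t) x \<le> L * bdry_dist \<Omega> (g t)"
        using *[OF t] by (intro bound \<open>g t \<in> \<Omega>\<close> x) blast
      then show ?thesis by (simp add: dist_norm)
    qed
    then show ?thesis by (rule rectifiable_John_curve[OF \<Omega>(1,2) L g])
  qed
  moreover have "2 * (L + 1) \<ge> 1" using L by simp
  ultimately show ?thesis unfolding one_John_domain_def using dom x0 by blast
qed

text \<open>For the given \<delta> the conditions are closed into a cycle John, boxing,
  isoperimetric, John. The John condition does not mention \<delta>, so returning to it from a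
  single \<delta> yields the isoperimetric inequality for all exponents with one constant.\<close>

theorem corollary1p11:
  fixes \<Omega> :: "(real ^ 'n) set" and \<delta> \<tau> :: real
  assumes "CARD('n) \<ge> 2"
    and "domain \<Omega>" and "bounded \<Omega>" and "separation_property \<Omega>"
    and "0 < \<delta>" "\<delta> < 1" and "0 < \<tau>" "\<tau> < 1"
  shows "(one_John_domain \<Omega> \<longleftrightarrow> boxing_inequality \<delta> \<tau> \<Omega>) \<and>
         (one_John_domain \<Omega> \<longleftrightarrow> (\<exists>C>0. isoperimetric_ineq C \<delta> \<tau> \<Omega>)) \<and>
         ((\<exists>C>0. isoperimetric_ineq C \<delta> \<tau> \<Omega>) \<longrightarrow>
            (\<exists>C>0. \<forall>\<delta>'\<in>{0<..<1}. isoperimetric_ineq C \<delta>' \<tau> \<Omega>))"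
proof -
  have "one_John_domain \<Omega> \<Longrightarrow> boxing_inequality \<delta> \<tau> \<Omega>"
    using John_imp_boxing assms by blast
  moreover have "boxing_inequality \<delta> \<tau> \<Omega> \<Longrightarrow> \<exists>C>0. isoperimetric_ineq C \<delta> \<tau> \<Omega>"
    using boxing_imp_isoperimetric assms by blast
  moreover have "\<exists>C>0. isoperimetric_ineq C \<delta> \<tau> \<Omega> \<Longrightarrow> one_John_domain \<Omega>"
    using isoperimetric_separation_imp_John assms by blast
  moreover have "one_John_domain \<Omega> \<Longrightarrow> \<exists>C>0. \<forall>\<delta>'\<in>{0<..<1}. isoperimetric_ineq C \<delta>' \<tau> \<Omega>"
    using John_imp_isoperimetric assms by blast
  ultimately show ?thesis by blast
qed

end
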